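(* Let $\mathds{T}_3$ be the $3$-graph on $[5]$ with edges $\{123,124,345\}$. There exist constants $N_0$ and $c>0$ such that for all integers $n\ge N_0$ and all integers $t\in[0,cn]$ we have \[ \mathrm{EX}(n,(t+1)\mathds{T}_3)=\{K_t^3\bowtie T_3(n-t,3)\}. \]
   Context: For $\ell\ge r$, $T_r(n,\ell)$ is the $r$-graph on $[n]=V_1\cup\dots\cup V_\ell$ with $|V_i|\in\{\lfloor n/\ell\rfloor,\lceil n/\ell\rceil\}$ whose edges are all $r$-sets containing at most one vertex from each $V_i$. $K_t^r$ is the complete $r$-graph on $t$ vertices. For $r$-graphs $\mathcal{G},\mathcal{H}$ on disjoint vertex sets, $\mathcal{G}\bowtie\mathcal{H}$ consists of the edges of both plus all $r$-subsets of $V(\mathcal{G})\cup V(\mathcal{H})$ meeting both. $\mathrm{EX}(n,(t+1)F)$ is the set (up to isomorphism) of $n$-vertex $r$-graphs not containing $t+1$ pairwise vertex-disjoint copies of $F$ with the maximum number of edges among such. *)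

theory Defs
  imports Complex_Main
begin

datatype 'a hypergraph = Hypergraph (verts: "'a set") (edges: "'a set set")

definition rgraph :: "nat \<Rightarrow> 'a hypergraph \<Rightarrow> bool" where
  "rgraph r G \<longleftrightarrow> finite (verts G) \<and> (\<forall>e\<in>edges G. e \<subseteq> verts G \<and> card e = r)"

definition hiso :: "'a hypergraph \<Rightarrow> 'b hypergraph \<Rightarrow> bool"  (infix "\<simeq>" 50) where
  "G \<simeq> H \<longleftrightarrow> (\<exists>f. bij_betw f (verts G) (verts H) \<and> (\<lambda>e. f ` e) ` edges G = edges H)"

(* Isomorphism classes are represented within hypergraphs on naturals: every finite
   hypergraph, on vertices of whatever type, is isomorphic to one of these. *)
definition iso_class :: "'a hypergraph \<Rightarrow> nat hypergraph set" where
  "iso_class G = {H. G \<simeq> H}"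

definition subhypergraph :: "'a hypergraph \<Rightarrow> 'a hypergraph \<Rightarrow> bool" where
  "subhypergraph H G \<longleftrightarrow> verts H \<subseteq> verts G \<and> edges H \<subseteq> edges G"

(* Copies are subgraphs, not necessarily induced. *)
definition contains_disjoint_copies :: "nat \<Rightarrow> 'b hypergraph \<Rightarrow> 'a hypergraph \<Rightarrow> bool" where
  "contains_disjoint_copies k F G \<longleftrightarrow>
     (\<exists>C :: nat \<Rightarrow> 'a hypergraph.
        (\<forall>i<k. subhypergraph (C i) G \<and> F \<simeq> C i) \<and>
        (\<forall>i<k. \<forall>j<k. i \<noteq> j \<longrightarrow> verts (C i) \<inter> verts (C j) = {}))"

definition free_rgraphs :: "nat \<Rightarrow> nat \<Rightarrow> nat \<Rightarrow> 'b hypergraph \<Rightarrow> nat hypergraph set" where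
  "free_rgraphs r n k F =
     {G. rgraph r G \<and> card (verts G) = n \<and> \<not> contains_disjoint_copies k F G}"

(* EX(n, kF) for r-graphs (the token EX is reserved), as a set of isomorphism classes *)
definition extremal_classes :: "nat \<Rightarrow> nat \<Rightarrow> nat \<Rightarrow> 'b hypergraph \<Rightarrow> nat hypergraph set set" where
  "extremal_classes r n k F =
     iso_class ` {G \<in> free_rgraphs r n k F.
                    \<forall>H \<in> free_rgraphs r n k F. card (edges H) \<le> card (edges G)}"

definition complete_rgraph :: "nat \<Rightarrow> nat \<Rightarrow> nat hypergraph" where
  "complete_rgraph r t = Hypergraph {1..t} {e. e \<subseteq> {1..t} \<and> card e = r}"

definition turan_part :: "nat \<Rightarrow> nat \<Rightarrow> nat \<Rightarrow> nat set" where
  "turan_part n l i = {v \<in> {1..n}. v mod l = i}"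

(* T_r(n,l), with the residue classes mod l as the balanced partition of [n];
   see turan_parts_partition and turan_part_balanced below *)
definition turan :: "nat \<Rightarrow> nat \<Rightarrow> nat \<Rightarrow> nat hypergraph" where
  "turan r n l =
     Hypergraph {1..n}
       {e. e \<subseteq> {1..n} \<and> card e = r \<and> (\<forall>i<l. card (e \<inter> turan_part n l i) \<le> 1)}"

(* The sum type makes the two vertex sets disjoint. *)
definition hjoin :: "nat \<Rightarrow> 'a hypergraph \<Rightarrow> 'b hypergraph \<Rightarrow> ('a + 'b) hypergraph" where
  "hjoin r G H =
     (let V = Inl ` verts G; W = Inr ` verts H in
      Hypergraph (V \<union> W)
        ((\<lambda>e. Inl ` e) ` edges G \<union> (\<lambda>e. Inr ` e) ` edges H \<union>
         {e. e \<subseteq> V \<union> W \<and> card e = r \<and> e \<inter> V \<noteq> {} \<and> e \<inter> W \<noteq> {}}))"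

definition T3 :: "nat hypergraph" where
  "T3 = Hypergraph {1..5} {{1,2,3}, {1,2,4}, {3,4,5}}"

lemma turan_parts_partition:
  assumes "l > 0"
  shows "(\<Union>i<l. turan_part n l i) = {1..n}"
    and "i \<noteq> j \<Longrightarrow> turan_part n l i \<inter> turan_part n l j = {}"
  using assms by (auto simp: turan_part_def)

lemma turan_part_Suc:
  "turan_part (Suc n) l i =
     (if Suc n mod l = i then insert (Suc n) (turan_part n l i) else turan_part n l i)"
  by (auto simp: turan_part_def le_Suc_eq)

lemma card_turan_part:
  assumes "i < l"
  shows "card (turan_part n l i) = n div l + (if 0 < i \<and> i \<le> n mod l then 1 else 0)"
proof (induction n)
  case 0
  then show ?case by (auto simp: turan_part_def)
next
  case (Suc n)
  have "Suc n \<notin> turan_part n l i" "finite (turan_part n l i)"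
    by (auto simp: turan_part_def)
  moreover have "n mod l < l" using assms by simp
  ultimately show ?case
    using Suc assms by (cases "i = 0") (auto simp: turan_part_Suc mod_Suc div_Suc)
qed

lemma turan_part_balanced:
  assumes "i < l"
  shows "int (card (turan_part n l i)) \<in> {\<lfloor>real n / real l\<rfloor>, \<lceil>real n / real l\<rceil>}"
proof -
  have fl: "\<lfloor>real n / real l\<rfloor> = int (n div l)"
    by (simp add: floor_divide_of_nat_eq)
  have "\<lceil>real n / real l\<rceil> = int (n div l) + 1" if "n mod l \<noteq> 0"
  proof -
    have "real n / real l = real (n div l) + real (n mod l) / real l"
      by (metis add.commute of_nat_add of_nat_of_nat_div_aux)
    moreover have "0 < real (n mod l) / real l" "real (n mod l) / real l < 1"
      using that assms by (auto simp: divide_simps)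
    ultimately show ?thesis by (intro ceiling_unique) auto
  qed
  then show ?thesis using fl card_turan_part[OF assms, of n] by auto
qed

end

theory Submission
  imports Defs
begin

text \<open>
  The engine is that two vertices \<open>x\<close>, \<open>y\<close> of an edge of a \<open>T3\<close>-free 3-graph have almost disjoint
  links. If all degrees exceed \<open>(1/10 + \<epsilon>) n\<^sup>2\<close>, then five pairwise adjacent vertices of the shadow
  graph would have links with more than \<open>n\<^sup>2 / 2\<close> pairs in total, so the shadow is \<open>K\<^sub>5\<close>-free; hence it
  has at most \<open>3 n\<^sup>2 / 8\<close> edges by Turan, and four pairwise adjacent vertices are impossible for the
  same reason. A 3-graph with \<open>K\<^sub>4\<close>-free shadow has at most as many edges as the balanced complete
  tripartite one, as one sees by deleting the vertices of one edge. Deleting vertices of small degree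
  reduces the Turan problem for \<open>T3\<close> to this situation, and also shows that a nearly extremal \<open>T3\<close>-free
  3-graph has maximum degree at most \<open>0.175 n\<^sup>2\<close>.

  For \<open>t + 1\<close> disjoint copies, use induction on \<open>t\<close>. If a vertex \<open>v\<close> has degree at least \<open>0.18 n\<^sup>2\<close>, then
  the graph without \<open>v\<close> has no \<open>t\<close> disjoint copies, since otherwise the vertices outside them would
  span a nearly extremal \<open>T3\<close>-free 3-graph in which \<open>v\<close> has too large a degree. If there is no such
  vertex, then the vertices of a maximal family of disjoint copies meet so few edges, and the rest spans so few
  by the case \<open>t = 0\<close>, that the 3-graph cannot be extremal.
\<close>

section \<open>Turan's bound\<close>

definition clique :: "'a set set \<Rightarrow> 'a set \<Rightarrow> bool" where
  "clique P Q \<longleftrightarrow> (\<forall>x\<in>Q. \<forall>y\<in>Q. x \<noteq> y \<longrightarrow> {x, y} \<in> P)"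

definition triples :: "'a set \<Rightarrow> 'a set set" where
  "triples V = {e. e \<subseteq> V \<and> card e = 3}"

definition shadow :: "'a set set \<Rightarrow> 'a set set" where
  "shadow E = {p. card p = 2 \<and> (\<exists>e\<in>E. p \<subseteq> e)}"

definition deg :: "'a set set \<Rightarrow> 'a \<Rightarrow> nat" where
  "deg E v = card {e \<in> E. v \<in> e}"

text \<open>The vertex sets of copies of \<open>T3\<close>, the triple system known as F5 or the
  generalised triangle: \<open>ab\<close> is the pair shared by two edges, and the third edge joins
  their remaining vertices \<open>c\<close> and \<open>d\<close>.\<close>

definition f5set :: "'a set set \<Rightarrow> 'a set \<Rightarrow> bool" where
  "f5set E X \<longleftrightarrow> (\<exists>a b c d e. distinct [a, b, c, d, e] \<and> X = {a, b, c, d, e} \<and>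
     {a, b, c} \<in> E \<and> {a, b, d} \<in> E \<and> {c, d, e} \<in> E)"

definition f5_free :: "'a set set \<Rightarrow> bool" where
  "f5_free E \<longleftrightarrow> (\<forall>X. \<not> f5set E X)"

text \<open>Turan's theorem for graphs without a clique on \<open>r + 2\<close> vertices, by
  induction on \<open>r\<close> and, inside it, on the number of vertices. If a clique
  \<open>Q\<close> of the largest permitted size exists, it is removed: a vertex outside
  \<open>Q\<close> misses some vertex of \<open>Q\<close>, since otherwise the clique could be
  enlarged. If there is none, the bound for a smaller \<open>r\<close> is even stronger.\<close>

lemma turan_bound:
  assumes "finite V" and "\<And>p. p \<in> P \<Longrightarrow> p \<subseteq> V \<and> card p = 2"
    and "\<And>Q. Q \<subseteq> V \<Longrightarrow> card Q = r + 2 \<Longrightarrow> \<not> clique P Q"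
  shows "2 * (r + 1) * card P \<le> r * (card V)\<^sup>2"
  using assms
proof (induction r arbitrary: V P)
  case 0
  have "P = {}"
  proof (rule ccontr)
    assume "P \<noteq> {}"
    then obtain p where p: "p \<in> P" by blast
    then obtain x y where xy: "p = {x, y}" "x \<noteq> y" using 0(2) by (meson card_2_iff)
    have "clique P p" using p xy by (auto simp: clique_def insert_commute)
    then show False using 0(2)[OF p] 0(3)[of p] by simp
  qed
  then show ?case by simp
next
  case (Suc r)
  note outer = Suc.IH
  from Suc.prems show ?case
  proof (induction "card V" arbitrary: V P rule: less_induct)
    case less
    have finP: "finite P"
      by (rule finite_subset[of _ "Pow V"]) (use less.prems in auto)
    show ?case
    proof (cases "\<exists>Q\<subseteq>V. card Q = r + 2 \<and> clique P Q")
      case False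
      then have "2 * (r + 1) * card P \<le> r * (card V)\<^sup>2"
        using outer[of V P] less.prems by blast
      \<comment> \<open>The densities r/(r+1) increase with \<open>r\<close>, which after clearing
        denominators is r(r+2) \<le> (r+1)^2.\<close>
      then have "(r + 2) * (2 * (r + 1) * card P) \<le> (r + 2) * (r * (card V)\<^sup>2)"
        by (rule mult_le_mono2)
      also have "\<dots> \<le> (r + 1) * ((r + 1) * (card V)\<^sup>2)"
        by (simp add: algebra_simps)
      finally have "(r + 1) * (2 * (r + 2) * card P) \<le> (r + 1) * ((r + 1) * (card V)\<^sup>2)"
        by (simp only: mult_ac)
      then show ?thesis by (simp only: mult_le_cancel1) simp
    next
      case True
      then obtain Q where Q: "Q \<subseteq> V" "card Q = r + 2" "clique P Q" by blast
      define q where "q = r + 2"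
      have finQ: "finite Q" using Q less.prems(1) finite_subset by blast
      define P0 where "P0 = {p \<in> P. p \<subseteq> V - Q}"
      define N where "N w = {x \<in> Q. {w, x} \<in> P}" for w
      have N: "card (N w) \<le> q - 1" if "w \<in> V - Q" for w
      proof -
        have "N w \<noteq> Q"
        proof
          assume "N w = Q"
          then have "\<And>x. x \<in> Q \<Longrightarrow> {w, x} \<in> P" by (auto simp: N_def)
          then have "clique P (insert w Q)"
            using Q(3) by (auto simp: clique_def insert_commute)
          moreover have "card (insert w Q) = Suc r + 2" using that finQ Q by simp
          ultimately show False using less.prems(3)[of "insert w Q"] that Q by auto
        qed
        then have "N w \<subset> Q" by (auto simp: N_def)
        then have "card (N w) < card Q" using finQ psubset_card_mono by blast
        then show ?thesis using Q q_def by simp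
      qed
      have cover: "P \<subseteq> P0 \<union> (\<Union>w\<in>V - Q. (\<lambda>x. {w, x}) ` N w) \<union> {p. p \<subseteq> Q \<and> card p = 2}"
      proof
        fix p assume p: "p \<in> P"
        then obtain x y where xy: "p = {x, y}" "x \<noteq> y" using less.prems(2) by (meson card_2_iff)
        have pV: "p \<subseteq> V" "card p = 2" using p less.prems(2) by auto
        consider "x \<in> Q" "y \<in> Q" | "x \<in> Q" "y \<notin> Q" | "x \<notin> Q" "y \<in> Q" | "x \<notin> Q" "y \<notin> Q" by blast
        then show "p \<in> P0 \<union> (\<Union>w\<in>V - Q. (\<lambda>x. {w, x}) ` N w) \<union> {p. p \<subseteq> Q \<and> card p = 2}"
        proof cases
          case 2
          then have "p \<in> (\<lambda>x. {y, x}) ` N y" using xy p by (auto simp: N_def insert_commute)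
          then show ?thesis using 2 pV xy by blast
        next
          case 3
          then have "p \<in> (\<lambda>y. {x, y}) ` N x" using xy p by (auto simp: N_def insert_commute)
          then show ?thesis using 3 pV xy by blast
        qed (use pV p xy in \<open>auto simp: P0_def\<close>)
      qed
      have fin: "finite P0" "finite (N w)" for w using finP finQ by (auto simp: P0_def N_def)
      have c1: "card (\<Union>w\<in>V - Q. (\<lambda>x. {w, x}) ` N w) \<le> (card V - q) * (q - 1)"
      proof -
        have "card (\<Union>w\<in>V - Q. (\<lambda>x. {w, x}) ` N w) \<le> (\<Sum>w\<in>V - Q. card ((\<lambda>x. {w, x}) ` N w))"
          by (rule card_UN_le) (use less.prems in auto)
        also have "\<dots> \<le> (\<Sum>w\<in>V - Q. q - 1)"
          by (rule sum_mono) (use N fin card_image_le le_trans in blast)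
        also have "\<dots> = (card V - q) * (q - 1)"
          using Q less.prems(1) finQ by (simp add: card_Diff_subset q_def)
        finally show ?thesis .
      qed
      have c2: "card {p. p \<subseteq> Q \<and> card p = 2} = q choose 2"
        using n_subsets[OF finQ, of 2] Q by (simp add: q_def)
      have "card P \<le> card (P0 \<union> (\<Union>w\<in>V - Q. (\<lambda>x. {w, x}) ` N w) \<union> {p. p \<subseteq> Q \<and> card p = 2})"
        by (rule card_mono[OF _ cover]) (use fin less.prems(1) finQ in auto)
      also have "\<dots> \<le> card P0 + (card V - q) * (q - 1) + (q choose 2)"
        using card_Un_le[of "P0 \<union> (\<Union>w\<in>V - Q. (\<lambda>x. {w, x}) ` N w)" "{p. p \<subseteq> Q \<and> card p = 2}"]
          card_Un_le[of P0 "\<Union>w\<in>V - Q. (\<lambda>x. {w, x}) ` N w"] c1 c2 by linarith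
      finally have P: "card P \<le> card P0 + (card V - q) * (q - 1) + (q choose 2)" .
      have VQ: "card (V - Q) = card V - q" "q \<le> card V"
        using Q less.prems(1) finQ card_mono[OF less.prems(1) Q(1)] by (auto simp: card_Diff_subset q_def)
      have "2 * (Suc r + 1) * card P0 \<le> Suc r * (card (V - Q))\<^sup>2"
      proof (rule less.hyps)
        show "card (V - Q) < card V" using VQ by (simp add: q_def)
        show "finite (V - Q)" using less.prems by simp
        show "p \<subseteq> V - Q \<and> card p = 2" if "p \<in> P0" for p
          using that less.prems by (auto simp: P0_def)
        show "\<not> clique P0 R" if "R \<subseteq> V - Q" "card R = Suc r + 2" for R
          using that less.prems(3)[of R] by (auto simp: clique_def P0_def)
      qed
      then have P0: "2 * q * card P0 \<le> (q - 1) * (card V - q)\<^sup>2"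
        using VQ by (simp add: q_def)
      obtain m where m: "card V = q + m" using VQ by (metis le_Suc_ex)
      have ch: "2 * (q choose 2) = q * (q - 1)"
        using even_mult_iff[of q "q - 1"] q_def by (simp add: choose_two)
      have "2 * q * card P \<le> 2 * q * card P0 + 2 * q * (m * (q - 1)) + q * (2 * (q choose 2))"
        using mult_le_mono2[OF P, of "2 * q"] m by (simp add: distrib_left mult_ac)
      also have "\<dots> \<le> (q - 1) * m\<^sup>2 + 2 * q * (m * (q - 1)) + q * (q * (q - 1))"
        using P0 m ch by simp
      also have "\<dots> = (q - 1) * (q + m)\<^sup>2"
        using q_def by (simp add: power2_eq_square distrib_left distrib_right mult_ac)
      finally show ?thesis using m by (simp add: q_def)
    qed
  qed
qed

section \<open>Links in the shadow graph\<close>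

lemma finite_triples: "finite V \<Longrightarrow> finite (triples V)"
  by (rule finite_subset[of _ "Pow V"]) (auto simp: triples_def)

lemma card_triples: "finite V \<Longrightarrow> card (triples V) = card V choose 3"
  by (simp add: triples_def n_subsets)

lemma edgeD:
  assumes "E \<subseteq> triples V" "e \<in> E"
  shows "e \<subseteq> V" "card e = 3" "finite e"
proof -
  show "e \<subseteq> V" "card e = 3" using assms by (auto simp: triples_def)
  then show "finite e" by (intro card_ge_0_finite) simp
qed

text \<open>No ground set is mentioned, because a clique of at least two vertices in the shadow
  consists of vertices of edges; see \<open>clique_shadow_subset\<close>.\<close>

definition no_clique4 :: "'a set set \<Rightarrow> bool" where
  "no_clique4 E \<longleftrightarrow> (\<forall>Q. card Q = 4 \<longrightarrow> \<not> clique (shadow E) Q)"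

lemma f5_free_mono: "f5_free E \<Longrightarrow> E' \<subseteq> E \<Longrightarrow> f5_free E'"
  unfolding f5_free_def f5set_def by blast

lemma card_pairs_containing:
  assumes "finite V" "E \<subseteq> triples V" and that: "x \<noteq> y"
  shows "card {e \<in> E. x \<in> e \<and> y \<in> e} \<le> card V"
proof -
  have "{e \<in> E. x \<in> e \<and> y \<in> e} \<subseteq> (\<lambda>z. {x, y, z}) ` V"
  proof
    fix e assume e: "e \<in> {e \<in> E. x \<in> e \<and> y \<in> e}"
    then have "card (e - {x, y}) = 1"
      using assms that by (subst card_Diff_subset) (auto simp: triples_def)
    then obtain z where "e - {x, y} = {z}" by (meson card_1_singletonE)
    then have "e = {x, y, z}" "z \<in> V" using e assms by (auto simp: triples_def)
    then show "e \<in> (\<lambda>z. {x, y, z}) ` V" by blast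
  qed
  then show ?thesis using assms(1) by (meson card_image_le card_mono finite_imageI le_trans)
qed

lemma deg_le_choose:
  assumes "finite V" "E \<subseteq> triples V"
  shows "deg E v \<le> (card V - 1) choose 2"
proof (cases "v \<in> V")
  case True
  have "inj_on (\<lambda>e. e - {v}) {e \<in> E. v \<in> e}"
    by (auto simp: inj_on_def)
  moreover have "(\<lambda>e. e - {v}) ` {e \<in> E. v \<in> e} \<subseteq> {p. p \<subseteq> V - {v} \<and> card p = 2}"
    using assms by (auto simp: triples_def)
  ultimately have "deg E v \<le> card {p. p \<subseteq> V - {v} \<and> card p = 2}"
    unfolding deg_def using assms(1) by (intro card_inj_on_le) auto
  then show ?thesis using assms True n_subsets[of "V - {v}" 2] by simp
next
  case False
  then have "{e \<in> E. v \<in> e} = {}" using assms by (auto simp: triples_def)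
  then show ?thesis unfolding deg_def by (simp only: card.empty)
qed

lemma card_eq_deg_plus:
  assumes "finite V" "E \<subseteq> triples V"
  shows "card E = deg E v + card (E \<inter> Pow (V - {v}))"
proof -
  have fin: "finite E" using assms finite_triples finite_subset by blast
  have "E = {e \<in> E. v \<in> e} \<union> (E \<inter> Pow (V - {v}))" using assms by (auto simp: triples_def)
  moreover have "{e \<in> E. v \<in> e} \<inter> (E \<inter> Pow (V - {v})) = {}" by auto
  ultimately show ?thesis unfolding deg_def
    using fin by (metis card_Un_disjoint finite_Un)
qed

lemma card_le_sum_deg:
  assumes "finite V" "E \<subseteq> triples V" "U \<subseteq> V"
  shows "card E \<le> (\<Sum>v\<in>U. deg E v) + card (E \<inter> Pow (V - U))"
proof -
  have fin: "finite E" using assms finite_triples finite_subset by blast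
  have finU: "finite U" using assms finite_subset by blast
  have "E \<subseteq> (\<Union>v\<in>U. {e \<in> E. v \<in> e}) \<union> (E \<inter> Pow (V - U))" using assms by (auto simp: triples_def)
  then have "card E \<le> card ((\<Union>v\<in>U. {e \<in> E. v \<in> e}) \<union> (E \<inter> Pow (V - U)))"
    using fin finU by (intro card_mono) auto
  also have "\<dots> \<le> card (\<Union>v\<in>U. {e \<in> E. v \<in> e}) + card (E \<inter> Pow (V - U))"
    by (rule card_Un_le)
  also have "card (\<Union>v\<in>U. {e \<in> E. v \<in> e}) \<le> (\<Sum>v\<in>U. deg E v)"
    unfolding deg_def by (rule card_UN_le[OF finU])
  finally show ?thesis by simp
qed

text \<open>Each deleted vertex shares at most \<open>card V\<close> edges with
  \<open>v\<close>.\<close>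

lemma deg_le_deg_remove:
  assumes "finite V" "E \<subseteq> triples V" "U \<subseteq> V" "v \<notin> U"
  shows "deg E v \<le> deg (E \<inter> Pow (V - U)) v + card U * card V"
proof -
  have fin: "finite E" using assms finite_triples finite_subset by blast
  have finU: "finite U" using assms finite_subset by blast
  have "{e \<in> E. v \<in> e} \<subseteq> {e \<in> E \<inter> Pow (V - U). v \<in> e} \<union> (\<Union>u\<in>U. {e \<in> E. v \<in> e \<and> u \<in> e})"
    using assms by (auto simp: triples_def)
  then have "deg E v \<le> card ({e \<in> E \<inter> Pow (V - U). v \<in> e} \<union> (\<Union>u\<in>U. {e \<in> E. v \<in> e \<and> u \<in> e}))"
    unfolding deg_def using fin finU by (intro card_mono) auto
  also have "\<dots> \<le> deg (E \<inter> Pow (V - U)) v + card (\<Union>u\<in>U. {e \<in> E. v \<in> e \<and> u \<in> e})"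
    unfolding deg_def by (rule card_Un_le)
  also have "card (\<Union>u\<in>U. {e \<in> E. v \<in> e \<and> u \<in> e}) \<le> (\<Sum>u\<in>U. card {e \<in> E. v \<in> e \<and> u \<in> e})"
    by (rule card_UN_le[OF finU])
  also have "\<dots> \<le> (\<Sum>u\<in>U. card V)"
    by (intro sum_mono card_pairs_containing[OF assms(1,2)]) (use assms(4) in auto)
  finally show ?thesis by simp
qed

lemma shadow_subset:
  assumes "E \<subseteq> triples V" "p \<in> shadow E"
  shows "p \<subseteq> V \<and> card p = 2"
  using assms by (auto simp: triples_def shadow_def)

lemma finite_shadow: "finite V \<Longrightarrow> E \<subseteq> triples V \<Longrightarrow> finite (shadow E)"
  by (rule finite_subset[of _ "Pow V"]) (use shadow_subset in blast)+

lemma shadow_iff: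
  assumes "x \<noteq> y"
  shows "{x, y} \<in> shadow E \<longleftrightarrow> (\<exists>e\<in>E. x \<in> e \<and> y \<in> e)"
  using assms by (auto simp: shadow_def)

lemma clique_mono: "clique P Q \<Longrightarrow> P \<subseteq> P' \<Longrightarrow> clique P' Q"
  unfolding clique_def by (meson subsetD)

lemma shadow_mono: "E \<subseteq> E' \<Longrightarrow> shadow E \<subseteq> shadow E'"
  by (auto simp: shadow_def)

lemma in_shadowI: "e \<in> E \<Longrightarrow> x \<in> e \<Longrightarrow> y \<in> e \<Longrightarrow> x \<noteq> y \<Longrightarrow> {x, y} \<in> shadow E"
  by (auto simp: shadow_def)

lemma no_clique4_mono: "no_clique4 E \<Longrightarrow> E' \<subseteq> E \<Longrightarrow> no_clique4 E'"
  unfolding no_clique4_def by (meson clique_mono shadow_mono)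

lemma clique_shadow_subset:
  assumes "E \<subseteq> triples V" "clique (shadow E) Q" "2 \<le> card Q"
  shows "Q \<subseteq> V"
proof
  fix x assume x: "x \<in> Q"
  have "\<not> Q \<subseteq> {x}" using assms(3) card_mono[of "{x}" Q] by auto
  then obtain y where "y \<in> Q" "x \<noteq> y" by blast
  then have "{x, y} \<in> shadow E" using x assms(2) by (simp add: clique_def)
  then show "x \<in> V" using shadow_subset[OF assms(1)] by blast
qed

lemma triple_obtain:
  assumes "e \<in> triples V" "x \<in> e"
  obtains y z where "e = {x, y, z}" "x \<noteq> y" "x \<noteq> z" "y \<noteq> z"
proof -
  have "card (e - {x}) = 2" using assms by (auto simp: triples_def)
  then obtain y z where "e - {x} = {y, z}" "y \<noteq> z" by (meson card_2_iff)
  then show thesis using that[of y z] assms(2) by blast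
qed

lemma triple_obtain2:
  assumes "e \<in> triples V" "x \<in> e" "y \<in> e" "x \<noteq> y"
  obtains z where "e = {x, y, z}" "x \<noteq> z" "y \<noteq> z"
proof -
  obtain a b where "e = {x, a, b}" "x \<noteq> a" "x \<noteq> b" "a \<noteq> b" using triple_obtain[OF assms(1,2)] .
  then show thesis using that assms by auto
qed

text \<open>If \<open>x\<close>, \<open>y\<close> lie in an edge \<open>xyz\<close>, then a pair avoiding \<open>z\<close> and common to the links of
  \<open>x\<close> and \<open>y\<close> completes it to a copy of \<open>T3\<close>. So the links of the vertices of a clique in the
  shadow are disjoint up to linearly many pairs.\<close>

lemma sum_deg_clique_le:
  assumes fin: "finite V" and E: "E \<subseteq> triples V" and free: "f5_free E"
    and QV: "Q \<subseteq> V" and Q: "clique (shadow E) Q"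
  shows "(\<Sum>x\<in>Q. deg E x) \<le> card (shadow E) + card Q ^ 3 * card V"
proof -
  have finQ: "finite Q" using QV fin finite_subset by blast
  have finE: "finite E" using E fin finite_triples finite_subset by blast
  have "\<forall>x\<in>Q. \<forall>y\<in>Q. x \<noteq> y \<longrightarrow> (\<exists>z. {x, y, z} \<in> E \<and> x \<noteq> z \<and> y \<noteq> z)"
  proof (intro ballI impI)
    fix x y assume xy: "x \<in> Q" "y \<in> Q" "x \<noteq> y"
    then have "{x, y} \<in> shadow E" using Q by (auto simp: clique_def)
    then obtain e where e: "e \<in> E" "x \<in> e" "y \<in> e" using xy shadow_iff by metis
    then obtain z where "e = {x, y, z}" "x \<noteq> z" "y \<noteq> z"
      using triple_obtain2[of e V x y] E xy by blast
    then show "\<exists>z. {x, y, z} \<in> E \<and> x \<noteq> z \<and> y \<noteq> z" using e by blast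
  qed
  then obtain z where z: "\<And>x y. x \<in> Q \<Longrightarrow> y \<in> Q \<Longrightarrow> x \<noteq> y \<Longrightarrow>
      {x, y, z x y} \<in> E \<and> x \<noteq> z x y \<and> y \<noteq> z x y"
    by metis
  \<comment> \<open>One third vertex \<open>z x y\<close> is fixed for each ordered pair in
    \<open>Q\<close>; on the diagonal \<open>z\<close> is unconstrained, which can only enlarge
    \<open>Z\<close>. Discarding the edges whose link pair meets \<open>Z\<close> costs at most
    \<open>card Q * card Q * card V\<close> edges at each vertex of \<open>Q\<close>, hence the
    cubic factor in the error term.\<close>
  define Z where "Z = (\<lambda>(x, y). z x y) ` (Q \<times> Q)"
  have finZ: "finite Z" using finQ by (auto simp: Z_def)
  have Z: "card Z \<le> card Q * card Q"
    unfolding Z_def using card_image_le[of "Q \<times> Q"] finQ by (metis card_cartesian_product finite_cartesian_product)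
  define M where "M x = {e \<in> E. x \<in> e \<and> (e - {x}) \<inter> Z = {}}" for x
  define L where "L x = (\<lambda>e. e - {x}) ` M x" for x
  have finL: "finite (L x)" "finite (M x)" for x using finE by (auto simp: L_def M_def)
  have M: "deg E x \<le> card (M x) + card Q * card Q * card V" for x
  proof -
    have "{e \<in> E. x \<in> e} \<subseteq> M x \<union> (\<Union>u\<in>Z - {x}. {e \<in> E. x \<in> e \<and> u \<in> e})"
      by (auto simp: M_def)
    then have "deg E x \<le> card (M x \<union> (\<Union>u\<in>Z - {x}. {e \<in> E. x \<in> e \<and> u \<in> e}))"
      unfolding deg_def using finE finZ finL by (intro card_mono) auto
    also have "\<dots> \<le> card (M x) + card (\<Union>u\<in>Z - {x}. {e \<in> E. x \<in> e \<and> u \<in> e})"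
      by (rule card_Un_le)
    also have "card (\<Union>u\<in>Z - {x}. {e \<in> E. x \<in> e \<and> u \<in> e})
        \<le> (\<Sum>u\<in>Z - {x}. card {e \<in> E. x \<in> e \<and> u \<in> e})"
      using finZ by (intro card_UN_le) auto
    also have "\<dots> \<le> (\<Sum>u\<in>Z - {x}. card V)"
      by (intro sum_mono card_pairs_containing[OF fin E]) auto
    also have "\<dots> \<le> card Q * card Q * card V"
      using Z card_Diff1_le[of Z x] by simp
    finally show ?thesis by simp
  qed
  have cL: "card (L x) = card (M x)" for x
    unfolding L_def by (rule card_image) (auto simp: inj_on_def M_def)
  have disj: "L x \<inter> L y = {}" if "x \<in> Q" "y \<in> Q" "x \<noteq> y" for x y
  proof (rule ccontr)
    assume "L x \<inter> L y \<noteq> {}"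
    then obtain p where p: "p \<in> L x" "p \<in> L y" by blast
    from p(1) obtain e where e: "e \<in> E" "x \<in> e" "p = e - {x}" "p \<inter> Z = {}"
      by (auto simp: L_def M_def)
    from p(2) obtain e' where e': "e' \<in> E" "y \<in> e'" "p = e' - {y}"
      by (auto simp: L_def M_def)
    obtain u w where uw: "e = {x, u, w}" "x \<noteq> u" "x \<noteq> w" "u \<noteq> w"
      using triple_obtain[of e V x] e E by blast
    have "e = {u, w, x}" "p = {u, w}" using uw e by auto
    moreover have "e' = {u, w, y}" using e' \<open>p = {u, w}\<close> by auto
    moreover have "z x y \<in> Z" using that by (auto simp: Z_def)
    ultimately have "distinct [u, w, x, y, z x y]" "{u, w, x} \<in> E" "{u, w, y} \<in> E" "{x, y, z x y} \<in> E"
      using z[OF that] e e' uw that by auto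
    then have "f5set E {u, w, x, y, z x y}" unfolding f5set_def by blast
    then show False using free by (simp add: f5_free_def)
  qed
  have "(\<Union>x\<in>Q. L x) \<subseteq> shadow E"
  proof
    fix p assume "p \<in> (\<Union>x\<in>Q. L x)"
    then obtain x e where "e \<in> E" "x \<in> e" "p = e - {x}" by (auto simp: L_def M_def)
    then show "p \<in> shadow E" using E by (auto simp: shadow_def triples_def)
  qed
  then have "card (\<Union>x\<in>Q. L x) \<le> card (shadow E)"
    using finite_shadow[OF fin E] by (rule card_mono[rotated])
  moreover have "card (\<Union>x\<in>Q. L x) = (\<Sum>x\<in>Q. card (L x))"
    using finQ finL disj by (intro card_UN_disjoint) auto
  moreover have "(\<Sum>x\<in>Q. deg E x) \<le> (\<Sum>x\<in>Q. card (L x) + card Q * card Q * card V)"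
    by (rule sum_mono) (use M cL in simp)
  ultimately show ?thesis by (simp add: sum.distrib power3_eq_cube)
qed

text \<open>Five times 0.101 exceeds 1/2, so five vertices cannot be pairwise adjacent in the
  shadow; four times 0.101 exceeds 3/8, the bound of \<open>turan_bound\<close> for a graph without
  five-cliques. The lower bound on \<open>card V\<close> makes the linear error terms of
  \<open>sum_deg_clique_le\<close> smaller than these gaps.\<close>

lemma min_deg_no_clique4:
  assumes fin: "finite V" and E: "E \<subseteq> triples V" and free: "f5_free E"
    and n: "card V \<ge> 100000"
    and d: "\<And>v. v \<in> V \<Longrightarrow> real (deg E v) \<ge> 101/1000 * (real (card V))\<^sup>2"
  shows "no_clique4 E"
  unfolding no_clique4_def
proof (intro allI impI notI)
  fix Q :: "'a set" assume Q4: "card Q = 4" and clQ: "clique (shadow E) Q"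
  have Q: "Q \<subseteq> V" "card Q = 4" using clique_shadow_subset[OF E clQ] Q4 by auto
  define n where "n = real (card V)"
  have n0: "100000 * n \<le> n\<^sup>2" using n by (auto simp: n_def power2_eq_square)
  have n1: "n \<ge> 100000" using n by (simp add: n_def)
  have le: "real (card R) * (101/1000 * n\<^sup>2) \<le> real (card (shadow E)) + real (card R ^ 3) * n"
    if "R \<subseteq> V" "clique (shadow E) R" for R
  proof -
    have "real (card R) * (101/1000 * n\<^sup>2) \<le> (\<Sum>x\<in>R. real (deg E x))"
      using sum_mono[of R "\<lambda>_. 101/1000 * n\<^sup>2" "\<lambda>x. real (deg E x)"] d that by (auto simp: n_def)
    also have "\<dots> = real (\<Sum>x\<in>R. deg E x)" by simp
    also have "\<dots> \<le> real (card (shadow E) + card R ^ 3 * card V)"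
      using sum_deg_clique_le[OF fin E free that] of_nat_le_iff by blast
    finally show ?thesis by (simp add: n_def)
  qed
  have K5: "\<not> clique (shadow E) R" if R: "R \<subseteq> V" "card R = 3 + 2" for R
  proof
    assume "clique (shadow E) R"
    moreover have "card (shadow E) \<le> card {p. p \<subseteq> V \<and> card p = 2}"
      using shadow_subset[OF E] fin by (intro card_mono) auto
    then have "card (shadow E) \<le> card V choose 2" using n_subsets[OF fin, of 2] by simp
    then have "2 * card (shadow E) \<le> card V * (card V - 1)" by (simp add: choose_two)
    then have "2 * card (shadow E) \<le> card V * card V" using le_trans diff_le_self mult_le_mono2 by metis
    then have "2 * real (card (shadow E)) \<le> n\<^sup>2" unfolding n_def power2_eq_square by (metis of_nat_le_iff of_nat_mult of_nat_numeral)
    ultimately show False using le[of R] R n0 n1 by auto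
  qed
  have "2 * (3 + 1) * card (shadow E) \<le> 3 * (card V)\<^sup>2"
    using turan_bound[of V "shadow E" 3] fin shadow_subset[OF E] K5 by blast
  then have "8 * real (card (shadow E)) \<le> 3 * n\<^sup>2"
    unfolding n_def using of_nat_mono[where 'a = real] by fastforce
  then show False using le[OF Q(1) clQ] Q n0 n1 by auto
qed

section \<open>Triple systems with a shadow without four-cliques\<close>

text \<open>The number of edges of the balanced complete tripartite triple system on
  \<open>n\<close> vertices, the factors being the part sizes in increasing order.\<close>

definition t3 :: "nat \<Rightarrow> nat" where
  "t3 n = (n div 3) * ((n + 1) div 3) * ((n + 2) div 3)"

text \<open>Colour 3 marks the vertices all of whose triples are edges; the other colours are the
  parts of a balanced complete tripartite hypergraph.\<close>

definition join_model :: "nat \<Rightarrow> nat \<Rightarrow> 'a set \<Rightarrow> 'a set set \<Rightarrow> bool" where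
  "join_model t s V E \<longleftrightarrow> (\<exists>\<kappa> :: 'a \<Rightarrow> nat. \<kappa> ` V \<subseteq> {..3} \<and> card {v \<in> V. \<kappa> v = 3} = t \<and>
     (\<forall>i<3. card {v \<in> V. \<kappa> v = i} = (s + i) div 3) \<and>
     E = {e \<in> triples V. 3 \<in> \<kappa> ` e \<or> inj_on \<kappa> e})"

text \<open>Put one new vertex into each part. The summands count the new edges with one, two and
  three new vertices: old pairs from different parts, one edge for each old vertex, and the new
  triple itself.\<close>

lemma t3_add3: "t3 (n + 3) = t3 n + n\<^sup>2 div 3 + n + 1"
proof -
  define q where "q = n div 3"
  consider "n = 3 * q" | "n = 3 * q + 1" | "n = 3 * q + 2"
    unfolding q_def by linarith
  then show ?thesis
  proof cases
    case 1
    then have "n\<^sup>2 div 3 = 3 * q * q" by (simp add: power2_eq_square)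
    moreover have "n div 3 = q" "(n + 1) div 3 = q" "(n + 2) div 3 = q"
      "(n + 3) div 3 = q + 1" "(n + 3 + 1) div 3 = q + 1" "(n + 3 + 2) div 3 = q + 1" using 1 by auto
    ultimately show ?thesis using 1 by (simp add: t3_def algebra_simps)
  next
    case 2
    have "n\<^sup>2 = 3 * (3 * q * q + 2 * q) + 1" unfolding 2 by (simp add: power2_eq_square algebra_simps)
    then have "n\<^sup>2 div 3 = 3 * q * q + 2 * q" by simp
    moreover have "n div 3 = q" "(n + 1) div 3 = q" "(n + 2) div 3 = q + 1"
      "(n + 3) div 3 = q + 1" "(n + 3 + 1) div 3 = q + 1" "(n + 3 + 2) div 3 = q + 2" using 2 by auto
    ultimately show ?thesis using 2 by (simp add: t3_def algebra_simps)
  next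
    case 3
    have "n\<^sup>2 = 3 * (3 * q * q + 4 * q + 1) + 1" unfolding 3 by (simp add: power2_eq_square algebra_simps)
    then have "n\<^sup>2 div 3 = 3 * q * q + 4 * q + 1" by simp
    moreover have "n div 3 = q" "(n + 1) div 3 = q + 1" "(n + 2) div 3 = q + 1"
      "(n + 3) div 3 = q + 1" "(n + 3 + 1) div 3 = q + 2" "(n + 3 + 2) div 3 = q + 2" using 3 by auto
    ultimately show ?thesis using 3 by (simp add: t3_def algebra_simps)
  qed
qed

lemma t3_Suc: "t3 (Suc n) = t3 n + ((n + 1) div 3) * ((n + 2) div 3)"
proof -
  have "(Suc n + 2) div 3 = n div 3 + 1" "(Suc n + 1) div 3 = (n + 2) div 3" "Suc n div 3 = (n + 1) div 3" by simp_all
  then show ?thesis unfolding t3_def by (simp only: distrib_left distrib_right mult_1_right mult_ac)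
qed

lemma t3_pos: "3 \<le> n \<Longrightarrow> 0 < t3 n"
  by (auto simp: t3_def div_greater_zero_iff)

text \<open>Lower each factor by one. The change of the product has the shape of
  \<open>t3_add3\<close>, with the sum of the pairwise products in place of the square term; that
  sum is at most a third of the square of the total.\<close>

lemma prod3_le_t3: "a * b * c \<le> t3 (a + b + c)"
proof (induction "a + b + c" arbitrary: a b c rule: less_induct)
  case less
  show ?case
  proof (cases "a = 0 \<or> b = 0 \<or> c = 0")
    case False
    then obtain a' b' c' where abc: "a = Suc a'" "b = Suc b'" "c = Suc c'" by (metis not0_implies_Suc)
    define n where "n = a' + b' + c'"
    have "a' * b' * c' \<le> t3 n" using less[of a' b' c'] abc by (simp add: n_def)
    moreover have "int (3 * (a' * b' + b' * c' + a' * c')) \<le> int (n\<^sup>2)"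
    proof -
      have "0 \<le> (int a' - int b')\<^sup>2 + (int b' - int c')\<^sup>2 + (int a' - int c')\<^sup>2" by simp
      then show ?thesis by (simp add: n_def power2_eq_square algebra_simps)
    qed
    then have "3 * (a' * b' + b' * c' + a' * c') \<le> n\<^sup>2" by (simp only: of_nat_le_iff)
    then have "a' * b' + b' * c' + a' * c' \<le> n\<^sup>2 div 3" by (simp add: less_eq_div_iff_mult_less_eq)
    moreover have "a * b * c = a' * b' * c' + (a' * b' + b' * c' + a' * c') + n + 1"
      by (simp add: abc n_def algebra_simps)
    moreover have "a + b + c = n + 3" by (simp add: abc n_def)
    ultimately show ?thesis using t3_add3[of n] by simp
  qed auto
qed

text \<open>If \<open>c\<close> exceeded \<open>a\<close> by two or more, moving one unit from
  \<open>c\<close> to \<open>a\<close> would increase the product by a positive multiple of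
  \<open>b\<close>, against \<open>prod3_le_t3\<close>. The condition \<open>3 \<le> n\<close> makes
  the product, and so \<open>b\<close>, positive.\<close>

lemma prod3_eq_t3_balanced:
  assumes "a \<le> b" "b \<le> c" "n = a + b + c" "a * b * c = t3 n" "3 \<le> n"
  shows "a = n div 3" "b = (n + 1) div 3" "c = (n + 2) div 3"
proof -
  have pos: "a * b * c > 0" using t3_pos assms by simp
  have "c < a + 2"
  proof (rule ccontr)
    assume "\<not> c < a + 2"
    then obtain d where d: "c = a + 2 + d" by (metis le_Suc_ex not_less)
    have "(a + 1) * b * (a + 1 + d) \<le> t3 (a + 1 + b + (a + 1 + d))" by (rule prod3_le_t3)
    also have "a + 1 + b + (a + 1 + d) = n" using assms d by simp
    finally have "(a + 1) * b * (a + 1 + d) \<le> a * b * (a + 2 + d)" using assms d by simp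
    then have "b * (d + 1) \<le> 0" by (simp add: algebra_simps)
    then show False using pos by simp
  qed
  then show "a = n div 3" "b = (n + 1) div 3" "c = (n + 2) div 3" using assms(1-3) by auto
qed

lemma card_transversals:
  fixes \<kappa> :: "'a \<Rightarrow> nat"
  assumes fin: "finite V" and \<kappa>: "\<kappa> ` V \<subseteq> {..<3}"
  shows "card {e \<in> triples V. inj_on \<kappa> e} =
    card {v \<in> V. \<kappa> v = 0} * card {v \<in> V. \<kappa> v = 1} * card {v \<in> V. \<kappa> v = 2}"
proof -
  define C where "C i = {v \<in> V. \<kappa> v = i}" for i
  have "bij_betw (\<lambda>(x, y, z). {x, y, z}) (C 0 \<times> C 1 \<times> C 2) {e \<in> triples V. inj_on \<kappa> e}"
  proof (rule bij_betw_imageI)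
    show "inj_on (\<lambda>(x, y, z). {x, y, z}) (C 0 \<times> C 1 \<times> C 2)"
    proof (rule inj_onI)
      fix p q assume p: "p \<in> C 0 \<times> C 1 \<times> C 2" and q: "q \<in> C 0 \<times> C 1 \<times> C 2"
        and pq: "(\<lambda>(x, y, z). {x, y, z}) p = (\<lambda>(x, y, z). {x, y, z}) q"
      obtain x y z where pe: "p = (x, y, z)" by (cases p)
      obtain x' y' z' where qe: "q = (x', y', z')" by (cases q)
      have eq: "{x, y, z} = {x', y', z'}" using pq pe qe by simp
      have "x \<in> C 0" "y \<in> C 1" "z \<in> C 2" "x' \<in> C 0" "y' \<in> C 1" "z' \<in> C 2"
        using p q pe qe by auto
      then have "\<kappa> x = 0" "\<kappa> y = 1" "\<kappa> z = 2" "\<kappa> x' = 0" "\<kappa> y' = 1" "\<kappa> z' = 2" by (auto simp: C_def)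
      moreover have "x \<in> {x', y', z'}" "y \<in> {x', y', z'}" "z \<in> {x', y', z'}" using eq by blast+
      ultimately show "p = q" using pe qe by auto
    qed
    show "(\<lambda>(x, y, z). {x, y, z}) ` (C 0 \<times> C 1 \<times> C 2) = {e \<in> triples V. inj_on \<kappa> e}"
    proof
      show "(\<lambda>(x, y, z). {x, y, z}) ` (C 0 \<times> C 1 \<times> C 2) \<subseteq> {e \<in> triples V. inj_on \<kappa> e}"
      proof (clarify)
        fix x y z assume "x \<in> C 0" "y \<in> C 1" "z \<in> C 2"
        then have k: "x \<in> V" "y \<in> V" "z \<in> V" "\<kappa> x = 0" "\<kappa> y = 1" "\<kappa> z = 2" by (auto simp: C_def)
        then have "x \<noteq> y" "x \<noteq> z" "y \<noteq> z" by auto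
        then show "{x, y, z} \<in> triples V \<and> inj_on \<kappa> {x, y, z}" using k by (simp add: triples_def)
      qed
      show "{e \<in> triples V. inj_on \<kappa> e} \<subseteq> (\<lambda>(x, y, z). {x, y, z}) ` (C 0 \<times> C 1 \<times> C 2)"
      proof
        fix e assume e: "e \<in> {e \<in> triples V. inj_on \<kappa> e}"
        then have "card (\<kappa> ` e) = 3" "\<kappa> ` e \<subseteq> {..<3}" using \<kappa> by (auto simp: card_image triples_def)
        then have im: "\<kappa> ` e = {..<3}" by (intro card_subset_eq) auto
        have "0 \<in> \<kappa> ` e" "1 \<in> \<kappa> ` e" "2 \<in> \<kappa> ` e" unfolding im by auto
        then obtain x y z where xyz: "x \<in> e" "\<kappa> x = 0" "y \<in> e" "\<kappa> y = 1" "z \<in> e" "\<kappa> z = 2"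
          by (smt (verit) imageE)
        then have "x \<noteq> y" "x \<noteq> z" "y \<noteq> z" by auto
        then have "{x, y, z} = e" using e xyz
          by (intro card_subset_eq) (auto simp: triples_def intro: card_ge_0_finite)
        moreover have "x \<in> C 0" "y \<in> C 1" "z \<in> C 2" using xyz e by (auto simp: C_def triples_def)
        ultimately show "e \<in> (\<lambda>(x, y, z). {x, y, z}) ` (C 0 \<times> C 1 \<times> C 2)" by blast
      qed
    qed
  qed
  then have "card {e \<in> triples V. inj_on \<kappa> e} = card (C 0 \<times> C 1 \<times> C 2)"
    by (simp add: bij_betw_same_card)
  then show ?thesis by (simp add: card_cartesian_product C_def)
qed

lemma clique4_shadow:
  assumes "{u, w, x} \<in> E" "{u, w, y} \<in> E" "g \<in> E" "x \<in> g" "y \<in> g" "distinct [u, w, x, y]"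
  shows "clique (shadow E) {u, w, x, y}"
proof -
  have "{u, w} \<in> shadow E" "{u, x} \<in> shadow E" "{w, x} \<in> shadow E" "{u, y} \<in> shadow E"
    "{w, y} \<in> shadow E" "{x, y} \<in> shadow E"
    using in_shadowI[OF assms(1)] in_shadowI[OF assms(2)] in_shadowI[OF assms(3)] assms(4-6) by simp_all
  then show ?thesis by (auto simp: clique_def insert_commute)
qed

text \<open>The edges are sorted by how many vertices they share with \<open>e\<close>. An edge
  \<open>f\<close> meeting \<open>e\<close> in one or two vertices is determined by
  \<open>f - e\<close>, because two different ones with the same trace outside \<open>e\<close>
  would give a four-clique in the shadow. With one common vertex the trace is a pair of the shadow
  outside \<open>e\<close>, so Turan's bound for graphs without four-cliques applies; with two it is
  a vertex adjacent to two vertices of \<open>e\<close>. The count of such vertices is left explicit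
  because the equality case needs it.\<close>

lemma remove_edge_bound:
  assumes fin: "finite V" and E: "E \<subseteq> triples V"
    and K4: "no_clique4 E"
    and e: "e \<in> E"
  shows "card E \<le> card (E \<inter> Pow (V - e)) + (card V - 3)\<^sup>2 div 3 +
    card {w \<in> V - e. \<exists>x\<in>e. \<exists>y\<in>e. x \<noteq> y \<and> {w, x} \<in> shadow E \<and> {w, y} \<in> shadow E} + 1"
proof -
  define W where "W = {w \<in> V - e. \<exists>x\<in>e. \<exists>y\<in>e. x \<noteq> y \<and> {w, x} \<in> shadow E \<and> {w, y} \<in> shadow E}"
  define P where "P = {p \<in> shadow E. p \<subseteq> V - e}"
  define E1 where "E1 = {f \<in> E. card (f \<inter> e) = 1}"
  define E2 where "E2 = {f \<in> E. card (f \<inter> e) = 2}"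
  have finE: "finite E" using E fin finite_triples finite_subset by blast
  have eV: "e \<subseteq> V" "card e = 3" "finite e" using edgeD[OF E e] by auto
  have no4: False if "{u, w, x} \<in> E" "{u, w, y} \<in> E" "x \<in> e" "y \<in> e" "distinct [u, w, x, y]" for u w x y
  proof -
    have "card {u, w, x, y} = 4" using that by auto
    then show False using K4 clique4_shadow[OF that(1,2) e that(3-5)] by (auto simp: no_clique4_def)
  qed
  have "2 * (2 + 1) * card P \<le> 2 * (card (V - e))\<^sup>2"
  proof (rule turan_bound)
    show "finite (V - e)" using fin by simp
    show "p \<subseteq> V - e \<and> card p = 2" if "p \<in> P" for p
      using that shadow_subset[OF E] by (auto simp: P_def)
    show "\<not> clique P Q" if "Q \<subseteq> V - e" "card Q = 2 + 2" for Q
      using that K4 clique_mono[of P Q "shadow E"] by (auto simp: P_def no_clique4_def)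
  qed
  then have P: "card P \<le> (card V - 3)\<^sup>2 div 3" using eV fin by (simp add: card_Diff_subset)
  have finP: "finite P" "finite W" using finite_shadow[OF fin E] fin by (auto simp: P_def W_def)
  have "card E1 \<le> card P"
  proof (rule card_inj_on_le)
    show "inj_on (\<lambda>f. f - e) E1"
    proof (rule inj_onI)
      fix f f' assume f: "f \<in> E1" "f' \<in> E1" "f - e = f' - e"
      then obtain x y where xy: "f \<inter> e = {x}" "f' \<inter> e = {y}" by (auto simp: E1_def card_1_singleton_iff)
      have "f \<in> triples V" "x \<in> f" using f E xy by (auto simp: E1_def)
      then obtain u w where uw: "f = {x, u, w}" "x \<noteq> u" "x \<noteq> w" "u \<noteq> w"
        by (rule triple_obtain)
      then have fe: "f - e = {u, w}" using xy by auto
      then have f': "f' = {y, u, w}" using f(3) xy by blast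
      show "f = f'"
      proof (rule ccontr)
        assume "f \<noteq> f'"
        then have "x \<noteq> y" using uw f' by auto
        moreover have "y \<noteq> u" "y \<noteq> w" using fe xy f(3) by auto
        ultimately show False using no4[of u w x y] uw f' f xy
          by (auto simp: E1_def insert_commute)
      qed
    qed
    show "(\<lambda>f. f - e) ` E1 \<subseteq> P"
    proof clarify
      fix f assume f: "f \<in> E1"
      have "card (f - e) = 2" using f E by (simp add: E1_def card_Diff_subset_Int triples_def eV subset_iff)
      then show "f - e \<in> P" using f E by (auto simp: E1_def P_def shadow_def triples_def)
    qed
  qed (use finP in auto)
  moreover have "card E2 \<le> card ((\<lambda>w. {w}) ` W)"
  proof (rule card_inj_on_le)
    have two: "\<exists>x y. f \<inter> e = {x, y} \<and> x \<noteq> y" if "f \<in> E2" for f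
      using that by (auto simp: E2_def card_2_iff)
    show "inj_on (\<lambda>f. f - e) E2"
    proof (rule inj_onI)
      fix f f' assume f: "f \<in> E2" "f' \<in> E2" "f - e = f' - e"
      then have c: "card (f \<inter> e) = 2" "card (f' \<inter> e) = 2" "f \<in> E" "f' \<in> E" by (auto simp: E2_def)
      obtain x y where xy: "f \<inter> e = {x, y}" "x \<noteq> y" using two f by blast
      have fin3: "f \<in> triples V" "x \<in> f" "y \<in> f" using c E xy by auto
      obtain w where w: "f = {x, y, w}" "x \<noteq> w" "y \<noteq> w"
        by (rule triple_obtain2[OF fin3 xy(2)])
      have ein3: "e \<in> triples V" "x \<in> e" "y \<in> e" using e E xy by auto
      obtain z where z: "e = {x, y, z}" "x \<noteq> z" "y \<noteq> z"
        by (rule triple_obtain2[OF ein3 xy(2)])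
      have fe: "f - e = {w}" using w xy by auto
      then have we: "w \<notin> e" "w \<in> f'" using f(3) by auto
      have f'U: "f' = insert w (f' \<inter> e)" using f(3) fe by blast
      obtain a b where ab: "f' \<inter> e = {a, b}" "a \<noteq> b" using two f by blast
      then have "a \<in> {x, y, z}" "b \<in> {x, y, z}" using z by blast+
      then consider "f' \<inter> e = {x, y}" | "f' \<inter> e = {x, z}" | "f' \<inter> e = {y, z}"
        using ab by auto
      then show "f = f'"
      proof cases
        case 1
        then show ?thesis using f'U w by auto
      next
        case 2
        then have "{w, x, y} \<in> E" "{w, x, z} \<in> E" using f'U w c by (auto simp: insert_commute)
        then show ?thesis using no4[of w x y z] z w xy we by auto
      next
        case 3
        then have "{w, y, x} \<in> E" "{w, y, z} \<in> E" using f'U w c by (auto simp: insert_commute)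
        then show ?thesis using no4[of w y x z] z w xy we by auto
      qed
    qed
    show "(\<lambda>f. f - e) ` E2 \<subseteq> (\<lambda>w. {w}) ` W"
    proof clarify
      fix f assume f: "f \<in> E2"
      then obtain x y where xy: "f \<inter> e = {x, y}" "x \<noteq> y" using two by blast
      have fin3: "f \<in> triples V" "x \<in> f" "y \<in> f" using f E xy by (auto simp: E2_def)
      obtain w where w: "f = {x, y, w}" "x \<noteq> w" "y \<noteq> w"
        by (rule triple_obtain2[OF fin3 xy(2)])
      have fe: "f - e = {w}" using w xy by auto
      have "w \<in> V" using f E w by (auto simp: E2_def triples_def)
      moreover have "{w, x} \<in> shadow E" "{w, y} \<in> shadow E"
        using in_shadowI[of f E] f w by (auto simp: E2_def)
      ultimately have "w \<in> W" using fe xy by (auto simp: W_def)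
      then show "f - e \<in> (\<lambda>w. {w}) ` W" using fe by blast
    qed
  qed (use finP in auto)
  moreover have "card ((\<lambda>w. {w}) ` W) \<le> card W" using finP card_image_le by blast
  moreover have "card E \<le> card (E \<inter> Pow (V - e)) + card E1 + card E2 + 1"
  proof -
    have "E \<subseteq> E \<inter> Pow (V - e) \<union> E1 \<union> E2 \<union> {e}"
    proof
      fix f assume f: "f \<in> E"
      have fV: "f \<subseteq> V" "card f = 3" "finite f" using edgeD[OF E f] by auto
      have "card (f \<inter> e) \<le> 3" using fV card_mono[of f "f \<inter> e"] by auto
      then consider "card (f \<inter> e) = 0" | "card (f \<inter> e) = 1" | "card (f \<inter> e) = 2" | "card (f \<inter> e) = 3"
        by linarith
      then show "f \<in> E \<inter> Pow (V - e) \<union> E1 \<union> E2 \<union> {e}"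
      proof cases
        case 1
        then have "f \<inter> e = {}" using fV by simp
        then show ?thesis using f fV by auto
      next
        case 4
        then have "f \<inter> e = f" "f \<inter> e = e"
          using fV eV card_subset_eq[of f "f \<inter> e"] card_subset_eq[of e "f \<inter> e"] by auto
        then show ?thesis by auto
      qed (use f in \<open>auto simp: E1_def E2_def\<close>)
    qed
    then have "card E \<le> card (E \<inter> Pow (V - e) \<union> E1 \<union> E2 \<union> {e})"
      using finE by (intro card_mono) (auto simp: E1_def E2_def)
    also have "\<dots> \<le> card (E \<inter> Pow (V - e)) + card E1 + card E2 + card {e}"
      by (intro card_Un_le[THEN order_trans] add_mono) auto
    finally show ?thesis by simp
  qed
  ultimately show ?thesis using P unfolding W_def by linarith
qed

text \<open>Deleting the vertices of an edge loses at most the increment of \<open>t3_add3\<close>,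
  so induction closes the bound.\<close>

lemma card_le_t3_if_no_clique4:
  assumes "finite V" "E \<subseteq> triples V"
 "no_clique4 E"
  shows "card E \<le> t3 (card V)"
  using assms
proof (induction "card V" arbitrary: V E rule: less_induct)
  case less
  show ?case
  proof (cases "E = {}")
    case False
    then obtain e where e: "e \<in> E" by blast
    then have eV: "e \<subseteq> V" "card e = 3" "finite e" using edgeD[OF less.prems(2)] by auto
    have c: "card (V - e) = card V - 3" "3 \<le> card V"
      using eV less.prems card_mono[of V e] by (auto simp: card_Diff_subset)
    have "card (E \<inter> Pow (V - e)) \<le> t3 (card (V - e))"
      by (rule less.hyps) (use c less.prems no_clique4_mono[OF less.prems(3)] in \<open>auto simp: triples_def\<close>)
    moreover have "card {w \<in> V - e. \<exists>x\<in>e. \<exists>y\<in>e. x \<noteq> y \<and> {w, x} \<in> shadow E \<and> {w, y} \<in> shadow E} \<le> card (V - e)"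
      using less.prems(1) by (intro card_mono) auto
    ultimately have "card E \<le> t3 (card V - 3) + (card V - 3)\<^sup>2 div 3 + (card V - 3) + 1"
      using remove_edge_bound[OF less.prems e] unfolding c(1) by linarith
    then show ?thesis using t3_add3[of "card V - 3"] c by simp
  qed simp
qed

text \<open>Serves to name the vertices of an edge so that the parts they define come in increasing
  size, the order in which \<open>join_model\<close> lists them.\<close>

lemma sort3:
  fixes f :: "'a \<Rightarrow> nat"
  assumes "card e = 3"
  obtains x y z where "e = {x, y, z}" "x \<noteq> y" "x \<noteq> z" "y \<noteq> z" "f x \<le> f y" "f y \<le> f z"
proof -
  obtain a b c where e: "e = {a, b, c}" "a \<noteq> b" "a \<noteq> c" "b \<noteq> c" using assms by (metis card_3_iff)
  consider "f a \<le> f b" "f b \<le> f c" | "f a \<le> f c" "f c \<le> f b" | "f b \<le> f a" "f a \<le> f c"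
    | "f b \<le> f c" "f c \<le> f a" | "f c \<le> f a" "f a \<le> f b" | "f c \<le> f b" "f b \<le> f a" by linarith
  then show thesis
  proof cases
    case 1 then show ?thesis using that[of a b c] e by auto
  next
    case 2 then show ?thesis using that[of a c b] e by (auto simp: insert_commute)
  next
    case 3 then show ?thesis using that[of b a c] e by (auto simp: insert_commute)
  next
    case 4 then show ?thesis using that[of b c a] e by (auto simp: insert_commute)
  next
    case 5 then show ?thesis using that[of c a b] e by (auto simp: insert_commute)
  next
    case 6 then show ?thesis using that[of c b a] e by (auto simp: insert_commute)
  qed
qed

text \<open>When equality holds, every vertex outside a fixed edge \<open>xyz\<close> is adjacent in the shadow to
  exactly two of \<open>x\<close>, \<open>y\<close>, \<open>z\<close>, and the non-neighbourhoods of these three form the parts.\<close>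

lemma join_model_if_no_clique4:
  assumes fin: "finite V" and E: "E \<subseteq> triples V"
    and K4: "no_clique4 E"
    and eq: "card E = t3 (card V)" and n: "3 \<le> card V"
  shows "join_model 0 (card V) V E"
proof -
  \<comment> \<open>\<open>{x, x}\<close> is a singleton and never in the shadow, so
    \<open>x\<close> belongs to its own class \<open>A x\<close>.\<close>
  define A where "A x = {w \<in> V. {w, x} \<notin> shadow E}" for x
  have finE: "finite E" using E fin finite_triples finite_subset by blast
  have "E \<noteq> {}" using eq t3_pos[OF n] by auto
  then obtain e where e: "e \<in> E" by blast
  then have eV: "e \<subseteq> V" "card e = 3" "finite e" using edgeD[OF E] by auto
  define W where "W = {w \<in> V - e. \<exists>x\<in>e. \<exists>y\<in>e. x \<noteq> y \<and> {w, x} \<in> shadow E \<and> {w, y} \<in> shadow E}"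
  have c: "card (V - e) = card V - 3" using eV fin by (simp add: card_Diff_subset)
  have "card (E \<inter> Pow (V - e)) \<le> t3 (card (V - e))"
    by (rule card_le_t3_if_no_clique4) (use fin E no_clique4_mono[OF K4] in \<open>auto simp: triples_def\<close>)
  \<comment> \<open>Equality in the edge count leaves no slack in \<open>remove_edge_bound\<close>:
    every vertex outside \<open>e\<close> has to be adjacent to two vertices of
    \<open>e\<close>.\<close>
  then have "card (V - e) \<le> card W"
    using remove_edge_bound[OF fin E K4 e, folded W_def] eq t3_add3[of "card V - 3"] n
    unfolding c by (simp only: le_add_diff_inverse2)
  moreover have "W \<subseteq> V - e" by (auto simp: W_def)
  ultimately have W: "W = V - e" using fin by (simp add: card_seteq)
  obtain x y z where xyz: "e = {x, y, z}" "x \<noteq> y" "x \<noteq> z" "y \<noteq> z"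
    and sorted: "card (A x) \<le> card (A y)" "card (A y) \<le> card (A z)"
    using sort3[OF eV(2), of "\<lambda>x. card (A x)"] .
  have ee: "{x, y} \<in> shadow E" "{x, z} \<in> shadow E" "{y, z} \<in> shadow E"
    using in_shadowI[OF e] xyz by simp_all
  then have ee': "{y, x} \<in> shadow E" "{z, x} \<in> shadow E" "{z, y} \<in> shadow E"
    by (auto simp: insert_commute)
  have self: "{v, v} \<notin> shadow E" for v by (simp add: shadow_def)
  have two: "{w, p} \<in> shadow E \<or> {w, q} \<in> shadow E" if "w \<in> V" "p \<in> e" "q \<in> e" "p \<noteq> q" for w p q
  proof (cases "w \<in> e")
    case True
    then show ?thesis using that xyz ee ee' by auto
  next
    case False
    then have "w \<in> W" using that W by auto
    then obtain a b where "a \<in> e" "b \<in> e" "a \<noteq> b" "{w, a} \<in> shadow E" "{w, b} \<in> shadow E"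
      by (auto simp: W_def)
    then show ?thesis using that xyz by auto
  qed
  \<comment> \<open>Two vertices of \<open>A p\<close> are both adjacent to the other two vertices
    of \<open>e\<close>. If they shared an edge, these four would form a clique.\<close>
  have indep: "A p \<inter> f = {} \<or> (\<exists>w. A p \<inter> f = {w})" if f: "f \<in> E" and p: "p \<in> e" for f p
  proof (rule ccontr)
    assume "\<not> ?thesis"
    then obtain w w' where w: "w \<in> A p" "w' \<in> A p" "w \<in> f" "w' \<in> f" "w \<noteq> w'" by blast
    then have ww: "{w, w'} \<in> shadow E" using f in_shadowI by metis
    have "e \<in> triples V" using e E by auto
    then obtain q r where qr: "e = {p, q, r}" "p \<noteq> q" "p \<noteq> r" "q \<noteq> r"
      using p by (rule triple_obtain)
    have adj: "{w, q} \<in> shadow E" "{w, r} \<in> shadow E" "{w', q} \<in> shadow E" "{w', r} \<in> shadow E"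
      using two[of w p q] two[of w p r] two[of w' p q] two[of w' p r] qr w by (auto simp: A_def)
    have "{q, r} \<in> shadow E" using in_shadowI[OF e] qr by simp
    then have "clique (shadow E) {w, w', q, r}" using adj ww by (auto simp: clique_def insert_commute)
    moreover have "w \<noteq> q" "w \<noteq> r" "w' \<noteq> q" "w' \<noteq> r" using adj self by auto
    then have "card {w, w', q, r} = 4" using w qr by auto
    ultimately show False using K4 by (auto simp only: no_clique4_def)
  qed
  define \<kappa> where "\<kappa> v = (if v \<in> A x then 0 else if v \<in> A y then 1 else 2 :: nat)" for v
  have cover: "v \<in> A x \<or> v \<in> A y \<or> v \<in> A z" if "v \<in> V" for v
  proof (rule ccontr)
    assume "\<not> ?thesis"
    then have a: "{v, x} \<in> shadow E" "{v, y} \<in> shadow E" "{v, z} \<in> shadow E" using that by (auto simp: A_def)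
    then have "v \<noteq> x" "v \<noteq> y" "v \<noteq> z" using self by auto
    then have "card {v, x, y, z} = 4" using xyz by auto
    moreover have "clique (shadow E) {v, x, y, z}" using a ee by (auto simp: clique_def insert_commute)
    ultimately show False using K4 by (auto simp only: no_clique4_def)
  qed
  have disj: "A x \<inter> A y = {}" "A x \<inter> A z = {}" "A y \<inter> A z = {}"
    using two[of _ x y] two[of _ x z] two[of _ y z] xyz by (auto simp: A_def)
  have "A p \<subseteq> V" for p by (auto simp: A_def)
  then have cls: "{v \<in> V. \<kappa> v = 0} = A x" "{v \<in> V. \<kappa> v = 1} = A y" "{v \<in> V. \<kappa> v = 2} = A z"
    using cover disj by (auto simp: \<kappa>_def split: if_splits)
  have \<kappa>2: "\<kappa> v < 3" for v by (simp add: \<kappa>_def)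
  have sub: "E \<subseteq> {e \<in> triples V. inj_on \<kappa> e}"
  proof
    fix f assume f: "f \<in> E"
    have "inj_on \<kappa> f"
    proof (rule inj_onI, rule ccontr)
      fix v w assume vw: "v \<in> f" "w \<in> f" "\<kappa> v = \<kappa> w" "v \<noteq> w"
      have "v \<in> V" "w \<in> V" using f vw E by (auto simp: triples_def)
      then have "\<exists>p\<in>e. v \<in> A p \<and> w \<in> A p" using vw(3) cover xyz by (auto simp: \<kappa>_def split: if_splits)
      then obtain p where p: "p \<in> e" "v \<in> A p \<inter> f" "w \<in> A p \<inter> f" using vw by blast
      from indep[OF f p(1)] show False
      proof
        assume "A p \<inter> f = {}"
        then show False using p by simp
      next
        assume "\<exists>u. A p \<inter> f = {u}"
        then show False using p vw(4) by (metis singletonD)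
      qed
    qed
    then show "f \<in> {e \<in> triples V. inj_on \<kappa> e}" using f E by auto
  qed
  have tr: "card {e \<in> triples V. inj_on \<kappa> e} = card (A x) * card (A y) * card (A z)"
    using card_transversals[OF fin, of \<kappa>] \<kappa>2 cls by auto
  have "V = A x \<union> A y \<union> A z" using cover by (auto simp: A_def)
  moreover have "finite (A p)" for p using fin by (auto simp: A_def)
  ultimately have sumV: "card V = card (A x) + card (A y) + card (A z)"
    using disj by (metis Int_Un_distrib2 card_Un_disjoint finite_Un sup_bot.right_neutral)
  \<comment> \<open>The chain t3 = |E| \<le> number of transversals = product of the part sizes
    \<le> t3 collapses, so all transversals are edges and the parts are balanced.\<close>
  have "card E \<le> card {e \<in> triples V. inj_on \<kappa> e}"
    using sub finite_triples[OF fin] by (intro card_mono) auto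
  then have prod: "card (A x) * card (A y) * card (A z) = t3 (card V)"
    using prod3_le_t3 tr eq sumV by (metis le_antisym)
  have "E = {e \<in> triples V. inj_on \<kappa> e}"
    using sub finite_triples[OF fin] prod tr eq by (intro card_subset_eq) auto
  moreover have "{v \<in> V. \<kappa> v = 3} = {}" using \<kappa>2 by (auto simp: less_le)
  moreover have "3 \<notin> \<kappa> ` f" for f using \<kappa>2 by (metis imageE less_irrefl)
  moreover have "card {v \<in> V. \<kappa> v = i} = (card V + i) div 3" if "i < 3" for i
  proof -
    have "i = 0 \<or> i = 1 \<or> i = 2" using that by auto
    then show ?thesis using prod3_eq_t3_balanced[OF sorted sumV prod n] cls by auto
  qed
  moreover have "\<kappa> ` V \<subseteq> {..3}" using \<kappa>2 less_imp_le by blast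
  ultimately show ?thesis unfolding join_model_def
    by (intro exI[of _ \<kappa>] conjI) (simp_all only: card.empty, auto)
qed

section \<open>Triple systems without a copy of T3\<close>

lemma t3_upper: "27 * real (t3 n) \<le> real n ^ 3"
  and t3_lower: "real n ^ 3 \<le> 27 * real (t3 n) + 3 * real n + 2"
proof -
  have "27 * real (t3 n) \<le> real n ^ 3 \<and> real n ^ 3 \<le> 27 * real (t3 n) + 3 * real n + 2"
  proof -
    define q where "q = real (n div 3)"
    have q0: "q \<ge> 0" by (simp add: q_def)
    consider "n = 3 * (n div 3)" | "n = 3 * (n div 3) + 1" | "n = 3 * (n div 3) + 2" by linarith
    then show ?thesis
    proof cases
      case 1
      then have "(n + 1) div 3 = n div 3" "(n + 2) div 3 = n div 3" by linarith+
      then have "real (t3 n) = q * q * q" by (simp add: t3_def q_def algebra_simps)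
      moreover have "real n = 3 * q" using 1 unfolding q_def by linarith
      ultimately show ?thesis by (simp add: power3_eq_cube)
    next
      case 2
      then have "(n + 1) div 3 = n div 3" "(n + 2) div 3 = n div 3 + 1" by linarith+
      then have "real (t3 n) = q * q * (q + 1)" by (simp add: t3_def q_def algebra_simps)
      moreover have "real n = 3 * q + 1" using 2 unfolding q_def by linarith
      ultimately show ?thesis using q0 by (simp add: power3_eq_cube algebra_simps)
    next
      case 3
      then have "(n + 1) div 3 = n div 3 + 1" "(n + 2) div 3 = n div 3 + 1" by linarith+
      then have "real (t3 n) = q * (q + 1) * (q + 1)" by (simp add: t3_def q_def algebra_simps)
      moreover have "real n = 3 * q + 2" using 3 unfolding q_def by linarith
      ultimately show ?thesis using q0 by (simp add: power3_eq_cube algebra_simps)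
    qed
  qed
  then show "27 * real (t3 n) \<le> real n ^ 3" "real n ^ 3 \<le> 27 * real (t3 n) + 3 * real n + 2" by auto
qed

text \<open>The increment is about n^2/9, and 1/9 exceeds 101/1000, the degree threshold of
  \<open>min_deg_no_clique4\<close>.\<close>

lemma t3_diff_lower:
  assumes "100000 \<le> Suc n"
  shows "101/1000 * (real (Suc n))\<^sup>2 \<le> real (t3 (Suc n)) - real (t3 n)"
proof -
  define r where "r = real (Suc n)"
  have r: "r \<ge> 100000" using assms unfolding r_def of_nat_le_iff[symmetric] by simp
  have a: "r - 2 \<le> 3 * real ((n + 1) div 3)" "r - 1 \<le> 3 * real ((n + 2) div 3)"
    unfolding r_def by linarith+
  have "(r - 2) * (r - 1) \<le> (3 * real ((n + 1) div 3)) * (3 * real ((n + 2) div 3))"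
    using a r by (intro mult_mono) auto
  also have "\<dots> = 9 * (real (t3 (Suc n)) - real (t3 n))"
    unfolding t3_Suc by (simp only: of_nat_add of_nat_mult) simp
  finally have "r\<^sup>2 - 3 * r \<le> 9 * (real (t3 (Suc n)) - real (t3 n))"
    by (simp add: power2_eq_square algebra_simps)
  moreover have "100000 * r \<le> r\<^sup>2" using r by (simp add: power2_eq_square)
  moreover have "101/1000 * x \<le> y" if "x - 3 * r \<le> 9 * y" "100000 * r \<le> x" for x y
    using that r by (simp add: field_simps)
  ultimately have "101/1000 * r\<^sup>2 \<le> real (t3 (Suc n)) - real (t3 n)" by blast
  then show ?thesis by (simp only: r_def)
qed

section \<open>Deleting vertices of small degree: the exact bound for one copy\<close>

lemma min_deg_t3_no_clique4:
  assumes "finite V" "E \<subseteq> triples V" "f5_free E" "card V = Suc n" "100000 \<le> Suc n"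
    and d: "\<And>v. v \<in> V \<Longrightarrow> t3 (Suc n) \<le> t3 n + deg E v"
  shows "no_clique4 E"
proof (rule min_deg_no_clique4)
  show "101/1000 * (real (card V))\<^sup>2 \<le> real (deg E v)" if "v \<in> V" for v
  proof -
    have "real (t3 (Suc n)) \<le> real (t3 n) + real (deg E v)"
      using d[OF that] by (metis of_nat_add of_nat_le_iff)
    then show ?thesis using t3_diff_lower[OF assms(5)] assms(4) by simp
  qed
qed (use assms in auto)

text \<open>On 100000 vertices the excess over \<open>t3\<close> is at most the number of all
  triples. Each further vertex uses up one unit of it, so from this order on no excess is
  left.\<close>

definition exact_from :: nat where
  "exact_from = 100000 + (100000 choose 3)"

text \<open>The excess over \<open>t3 n\<close> grows by at least one with every vertex of small degree that is
  deleted, but it cannot exceed the number of triples at the end.\<close>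

lemma f5_free_excess:
  assumes "finite V" "E \<subseteq> triples V" "f5_free E" "card V = 100000 + k"
  shows "card E \<le> t3 (card V) + (exact_from - card V)"
  using assms
proof (induction k arbitrary: V E)
  case 0
  have "card E \<le> card V choose 3"
    using 0 card_mono[OF finite_triples] card_triples by metis
  moreover have "card V = 100000" using 0(4) by simp
  then have "exact_from - card V = card V choose 3"
    unfolding exact_from_def by (metis add_diff_cancel_left')
  ultimately show ?case by linarith
next
  case (Suc k)
  define n where "n = 100000 + k"
  have Vn: "card V = Suc n" using Suc.prems by (simp add: n_def)
  show ?case
  proof (cases "\<forall>v\<in>V. t3 (Suc n) \<le> t3 n + deg E v")
    case True
    then have "no_clique4 E"
      using Suc.prems Vn by (intro min_deg_t3_no_clique4[where V = V and n = n]) (auto simp: n_def)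
    then show ?thesis
      using card_le_t3_if_no_clique4[OF Suc.prems(1,2)] trans_le_add1 by metis
  next
    case False
    then obtain v where v: "v \<in> V" "t3 n + deg E v < t3 (Suc n)" by auto
    have Vv: "card (V - {v}) = n" using v Vn by (metis card_Diff_singleton diff_Suc_1)
    have "card (E \<inter> Pow (V - {v})) \<le> t3 (card (V - {v})) + (exact_from - card (V - {v}))"
      by (rule Suc.IH) (use Suc.prems Vv f5_free_mono[OF Suc.prems(3)] in \<open>auto simp: triples_def n_def\<close>)
    then have "card (E \<inter> Pow (V - {v})) \<le> t3 n + (exact_from - n)" using Vv by simp
    moreover have "card E = deg E v + card (E \<inter> Pow (V - {v}))"
      by (rule card_eq_deg_plus[OF Suc.prems(1,2)])
    \<comment> \<open>The degree of \<open>v\<close> is strictly below the increment of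
      \<open>t3\<close>; the unit gained pays for the drop of the truncated difference
      \<open>exact_from - card V\<close>.\<close>
    ultimately show ?thesis using v(2) Vn by simp
  qed
qed

lemma exact_from_ge: "100000 \<le> exact_from"
  unfolding exact_from_def by (rule le_add1)

lemma f5_free_card_le:
  assumes "finite V" "E \<subseteq> triples V" "f5_free E" "exact_from \<le> card V"
  shows "card E \<le> t3 (card V)"
  using f5_free_excess[OF assms(1-3), of "card V - 100000"] assms(4) exact_from_ge by simp

text \<open>The strict lower bound on \<open>card V\<close> allows \<open>f5_free_card_le\<close> to
  be used after one deletion. Hence in an extremal system every degree is at least the increment of
  \<open>t3\<close>, which excludes four-cliques.\<close>

lemma f5_free_extremal:
  assumes "finite V" "E \<subseteq> triples V" "f5_free E" "exact_from < card V"
    and eq: "card E = t3 (card V)"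
  shows "join_model 0 (card V) V E"
proof (rule join_model_if_no_clique4)
  obtain n where n: "card V = Suc n" using assms(4) by (cases "card V") auto
  show "no_clique4 E"
  proof (rule min_deg_t3_no_clique4)
    fix v assume v: "v \<in> V"
    have "card (V - {v}) = n" using v n assms(1) by simp
    then have "card (E \<inter> Pow (V - {v})) \<le> t3 n"
      using f5_free_card_le[of "V - {v}" "E \<inter> Pow (V - {v})"] assms n f5_free_mono[OF assms(3)]
      by (auto simp: triples_def)
    then show "t3 (Suc n) \<le> t3 n + deg E v"
      using card_eq_deg_plus[OF assms(1,2), of v] eq n by simp
  qed (use assms n exact_from_ge in auto)
qed (use assms exact_from_ge in auto)

text \<open>A vertex \<open>u\<close> of maximum degree \<open>\<Delta>\<close> has a triangle-free link, so \<open>\<Delta> \<le> D\<^sup>2 / 4\<close> for its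
  number \<open>D\<close> of neighbours; and every edge has a vertex outside the neighbourhood of \<open>u\<close>.\<close>

lemma no_clique4_deg_bound:
  assumes fin: "finite V" and E: "E \<subseteq> triples V" and K4: "no_clique4 E"
    and v: "v \<in> V" "real (deg E v) \<ge> 16/100 * (real (card V))\<^sup>2"
  shows "real (card E) \<le> 32/1000 * real (card V) ^ 3"
proof -
  have finE: "finite E" using E fin finite_triples finite_subset by blast
  define \<Delta> where "\<Delta> = Max (deg E ` V)"
  have "\<Delta> \<in> deg E ` V" unfolding \<Delta>_def using fin v by (intro Max_in) auto
  then obtain u where u: "u \<in> V" "deg E u = \<Delta>" by auto
  have max: "deg E w \<le> \<Delta>" if "w \<in> V" for w using that fin by (auto simp: \<Delta>_def)
  define N where "N = {w \<in> V. {u, w} \<in> shadow E}"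
  have uN: "u \<notin> N" by (simp add: N_def shadow_def)
  have finN: "finite N" "N \<subseteq> V" using fin by (auto simp: N_def)
  define L where "L = (\<lambda>e. e - {u}) ` {e \<in> E. u \<in> e}"
  have cL: "card L = \<Delta>"
    unfolding L_def u(2)[symmetric] deg_def by (rule card_image) (auto simp: inj_on_def)
  have Lsh: "L \<subseteq> shadow E" using edgeD[OF E] by (auto simp: L_def shadow_def)
  have "2 * (1 + 1) * card L \<le> 1 * (card N)\<^sup>2"
  proof (rule turan_bound)
    fix p assume p: "p \<in> L"
    then obtain e where e: "e \<in> E" "u \<in> e" "p = e - {u}" by (auto simp: L_def)
    have "w \<in> N" if "w \<in> p" for w
      using in_shadowI[OF e(1,2), of w] that e edgeD[OF E e(1)] by (auto simp: N_def)
    then show "p \<subseteq> N \<and> card p = 2" using e edgeD[OF E e(1)] by auto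
  next
    fix Q assume Q: "Q \<subseteq> N" "card Q = 1 + 2"
    show "\<not> clique L Q"
    proof
      assume "clique L Q"
      then have "clique (shadow E) Q" using Lsh clique_mono by blast
      then have "clique (shadow E) (insert u Q)"
        using Q by (auto simp: clique_def N_def insert_commute)
      moreover have "card (insert u Q) = 4" using Q uN finN finite_subset[of Q N] by (subst card_insert_disjoint) auto
      ultimately show False using K4 by (simp add: no_clique4_def)
    qed
  qed (use finN in simp)
  then have \<Delta>: "4 * \<Delta> \<le> (card N)\<^sup>2" using cL by simp
  have "E \<inter> Pow (V - (V - N)) = {}"
  proof (rule ccontr)
    assume "E \<inter> Pow (V - (V - N)) \<noteq> {}"
    then obtain e where e: "e \<in> E" "e \<subseteq> N" by auto
    have "clique (shadow E) (insert u e)"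
      using e in_shadowI[OF e(1)] by (auto simp: clique_def N_def insert_commute)
    moreover have "card (insert u e) = 4" using edgeD[OF E e(1)] e uN by (subst card_insert_disjoint) auto
    ultimately show False using K4 by (simp add: no_clique4_def)
  qed
  then have "card E \<le> (\<Sum>w\<in>V - N. deg E w)"
    using card_le_sum_deg[OF fin E, of "V - N"] by simp
  also have "\<dots> \<le> (\<Sum>w\<in>V - N. \<Delta>)" by (rule sum_mono) (use max in auto)
  also have "\<dots> = (card V - card N) * \<Delta>" using finN fin by (simp add: card_Diff_subset)
  finally have c: "card E \<le> (card V - card N) * \<Delta>" .
  define D where "D = real (card N)"
  define w where "w = real (card V)"
  have Dw: "D \<le> w" "0 \<le> D" using finN fin by (auto simp: D_def w_def card_mono)
  have d4: "4 * real \<Delta> \<le> D\<^sup>2" unfolding D_def using \<Delta> of_nat_mono[where 'a = real] by fastforce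
  have "16/100 * w\<^sup>2 \<le> real \<Delta>" using v max[OF v(1)] unfolding w_def by linarith
  then have "(8/10 * w)\<^sup>2 \<le> D\<^sup>2" using d4 by (simp add: power2_eq_square)
  then have D8: "8/10 * w \<le> D" using Dw(2) by (rule power2_le_imp_le)
  have "real (card E) \<le> (w - D) * real \<Delta>"
    using c finN fin card_mono[of V N] unfolding D_def w_def
    by (metis of_nat_diff of_nat_le_iff of_nat_mult)
  also have "\<dots> \<le> (w - D) * (D\<^sup>2 / 4)" using d4 Dw by (intro mult_left_mono) auto
  \<comment> \<open>For \<open>D\<close> at least \<open>8/10 * w\<close> the left side is largest
    at \<open>D = 8/10 * w\<close>, with value 0.2 * 0.16 * w^3. Accordingly
    \<open>D - 8/10 * w\<close> is a factor of the difference, and the quadratic cofactor is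
    nonnegative on this range.\<close>
  also have "\<dots> \<le> 32/1000 * w ^ 3"
  proof -
    have "(8/10 * w) * D \<le> D * D" using D8 Dw(2) by (rule mult_right_mono)
    moreover have "(8/10 * w)\<^sup>2 \<le> D\<^sup>2" using D8 Dw by (intro power_mono) auto
    ultimately have "2/10 * (w * D) \<le> 1/4 * (D * D)" "16/100 * (w * w) \<le> 1/4 * (D * D)" "0 \<le> D * D"
      by (simp_all add: power2_eq_square)
    then have "0 \<le> D * D - 2/10 * (w * D) - 16/100 * (w * w)" by linarith
    then have "0 \<le> D\<^sup>2 - 2/10 * w * D - 16/100 * w\<^sup>2" by (simp only: power2_eq_square mult.assoc)
    then have "0 \<le> (D - 8/10 * w) * (D\<^sup>2 - 2/10 * w * D - 16/100 * w\<^sup>2)"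
      using D8 by (intro mult_nonneg_nonneg) auto
    then show ?thesis by (simp add: power2_eq_square power3_eq_cube field_simps)
  qed
  finally show ?thesis by (simp add: w_def)
qed

lemma finite_arg_max:
  fixes f :: "'a \<Rightarrow> real"
  assumes "finite S" "S \<noteq> {}"
  obtains x where "x \<in> S" "\<And>y. y \<in> S \<Longrightarrow> f y \<le> f x"
proof -
  have "Max (f ` S) \<in> f ` S" using assms by simp
  then obtain x where "x \<in> S" "f x = Max (f ` S)" by auto
  then show thesis using that[of x] assms by simp
qed

text \<open>Maximising \<open>|E[W]| - 0.034 |W|\<^sup>3\<close> over the sets \<open>W\<close> containing \<open>v\<close> removes the vertices of
  small degree, and only few of them, since \<open>|E[W]|\<close> is at most \<open>|W|\<^sup>3 / 27\<close>.\<close>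

lemma near_extremal_deg_less:
  assumes fin: "finite V" and E: "E \<subseteq> triples V" and free: "f5_free E"
    and big: "10 * exact_from \<le> card V" and v: "v \<in> V"
    and e: "(1/27 - 1/10000) * real (card V) ^ 3 \<le> real (card E)"
  shows "real (deg E v) < 175/1000 * (real (card V))\<^sup>2"
proof (rule ccontr)
  assume "\<not> ?thesis"
  then have dv: "175/1000 * (real (card V))\<^sup>2 \<le> real (deg E v)" by simp
  \<comment> \<open>The coefficient 0.034 lies below 1/27, so that \<open>V\<close> itself has a
    positive value; above 0.032, so that \<open>no_clique4_deg_bound\<close> ends in a
    contradiction; and three times it exceeds 0.101, so that a maximiser has large degrees.\<close>
  define \<phi> where "\<phi> W = real (card (E \<inter> Pow W)) - 34/1000 * real (card W) ^ 3" for W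
  obtain W where W: "W \<in> {W. W \<subseteq> V \<and> v \<in> W}"
    and max: "\<And>X. X \<in> {W. W \<subseteq> V \<and> v \<in> W} \<Longrightarrow> \<phi> X \<le> \<phi> W"
    by (rule finite_arg_max[of "{W. W \<subseteq> V \<and> v \<in> W}" \<phi>]) (use fin v in auto)
  have WV: "W \<subseteq> V" "v \<in> W" "finite W" using W fin finite_subset by auto
  define F where "F = E \<inter> Pow W"
  have F: "F \<subseteq> triples W" "f5_free F"
    using E f5_free_mono[OF free] by (auto simp: F_def triples_def)
  define m where "m = real (card V)"
  define w where "w = real (card W)"
  have wm: "0 \<le> w" "w \<le> m" using WV fin card_mono by (auto simp: w_def m_def)
  have m: "m \<ge> 10 * real exact_from" "m > 0"
    using big exact_from_ge of_nat_mono[OF big, where 'a = real] by (auto simp: m_def)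
  have "E \<inter> Pow V = E" using E by (auto simp: triples_def)
  \<comment> \<open>Here 793/270000 = 1/27 - 1/10000 - 34/1000; the coefficient 82/27000 further
    down is 1/27 - 34/1000.\<close>
  then have FW: "793/270000 * m ^ 3 \<le> real (card F) - 34/1000 * w ^ 3"
    using max[of V] v e by (simp add: \<phi>_def F_def m_def w_def algebra_simps)
  have "exact_from \<le> card W"
  proof (rule ccontr)
    assume "\<not> exact_from \<le> card W"
    then have w10: "w \<le> m / 10" using m unfolding w_def by simp
    have "card F \<le> card (triples W)" using F WV finite_triples by (intro card_mono) auto
    also have "\<dots> \<le> card W ^ 3" using card_triples[OF WV(3)] binomial_le_pow2
      by (metis binomial_le_pow binomial_eq_0 le0 not_less)
    finally have "real (card F) \<le> w ^ 3" unfolding w_def by (metis of_nat_le_iff of_nat_power)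
    moreover have "w ^ 3 \<le> (m / 10) ^ 3" using w10 wm by (intro power_mono) auto
    moreover have "0 \<le> w ^ 3" "0 < m ^ 3" using wm m by auto
    moreover have "(m / 10) ^ 3 = m ^ 3 / 1000" by (simp add: power_divide)
    ultimately show False using FW by linarith
  qed
  then have Wbig: "exact_from \<le> card W" "100000 \<le> card W" using exact_from_ge by auto
  have "real (card F) \<le> w ^ 3 / 27"
    using f5_free_card_le[OF WV(3) F Wbig(1)] t3_upper[of "card W"] unfolding w_def
    by (metis of_nat_le_iff order_trans pos_le_divide_eq mult.commute zero_less_numeral)
  then have w3: "793/270000 * m ^ 3 \<le> 82/27000 * w ^ 3"
    using FW by simp
  \<comment> \<open>\<open>w3\<close> says that w^3 is at least 793/820 times m^3, while 0.985^3 <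
    0.956 < 793/820.\<close>
  have w985: "985/1000 * m \<le> w"
  proof (rule ccontr)
    assume "\<not> ?thesis"
    then have "w ^ 3 \<le> (985/1000 * m) ^ 3" using wm by (intro power_mono) auto
    then have "w ^ 3 \<le> (985/1000) ^ 3 * m ^ 3" by (simp only: power_mult_distrib)
    moreover have "0 < m ^ 3" using m by simp
    moreover have "(985/1000 :: real) ^ 3 \<le> 956/1000" by (simp add: power3_eq_cube)
    then have "(985/1000) ^ 3 * m ^ 3 \<le> 956/1000 * m ^ 3" using m by (intro mult_right_mono) auto
    ultimately show False using w3 by linarith
  qed
  have w1: "w \<ge> 100000" using Wbig(2) unfolding w_def by linarith
  \<comment> \<open>Removing \<open>u\<close> from the maximiser cannot increase
    \<open>\<phi>\<close>, so the degree of \<open>u\<close> is at least the loss in the cubic term,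
    about 0.102 * w^2. The vertex \<open>v\<close> is exempt because the competing sets must contain
    it.\<close>
  have dW: "101/1000 * w\<^sup>2 \<le> real (deg F u)" if u: "u \<in> W" "u \<noteq> v" for u
  proof -
    have "F \<inter> Pow (W - {u}) = E \<inter> Pow (W - {u})" by (auto simp: F_def)
    then have "card F = deg F u + card (E \<inter> Pow (W - {u}))"
      using card_eq_deg_plus[OF WV(3) F(1), of u] by simp
    moreover have "\<phi> (W - {u}) \<le> \<phi> W" using WV u by (intro max) auto
    moreover have "real (card (W - {u})) = w - 1"
      using u WV card_gt_0_iff[of W] by (auto simp: w_def of_nat_diff card_Diff_singleton Suc_le_eq)
    ultimately have "34/1000 * (w ^ 3 - (w - 1) ^ 3) \<le> real (deg F u)"
      by (simp add: \<phi>_def F_def[symmetric] w_def[symmetric] algebra_simps)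
    moreover have "w ^ 3 - (w - 1) ^ 3 = 3 * (w * w) - 3 * w + 1"
      by (simp add: power3_eq_cube algebra_simps)
    moreover have "100000 * w \<le> w * w" using w1 by simp
    ultimately show ?thesis by (simp add: power2_eq_square)
  qed
  have "V - (V - W) = W" using WV by auto
  then have "deg E v \<le> deg F v + card (V - W) * card V"
    using deg_le_deg_remove[OF fin E, of "V - W" v] WV by (simp add: F_def)
  then have "real (deg E v) \<le> real (deg F v) + real (card (V - W)) * m"
    unfolding m_def by (metis of_nat_add of_nat_le_iff of_nat_mult)
  moreover have "real (card (V - W)) = m - w"
    using WV fin card_mono[of V W] by (simp add: card_Diff_subset m_def w_def of_nat_diff)
  moreover have "(m - w) * m \<le> (15/1000 * m) * m" using w985 m by (intro mult_right_mono) auto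
  moreover have "w\<^sup>2 \<le> m\<^sup>2" using wm by (intro power_mono) auto
  \<comment> \<open>At most 0.015 * m vertices are missing from \<open>W\<close>, so
    \<open>v\<close> loses at most 0.015 * m^2 of its 0.175 * m^2 edges.\<close>
  ultimately have dv16: "16/100 * w\<^sup>2 \<le> real (deg F v)"
    using dv unfolding m_def[symmetric] by (simp add: power2_eq_square)
  have "no_clique4 F"
  proof (rule min_deg_no_clique4[OF WV(3) F Wbig(2)])
    fix u assume "u \<in> W"
    then show "101/1000 * (real (card W))\<^sup>2 \<le> real (deg F u)"
      using dW[of u] dv16 zero_le_power2[of w] unfolding w_def[symmetric] by (cases "u = v") (simp, simp)
  qed
  then have "real (card F) \<le> 32/1000 * w ^ 3"
    using no_clique4_deg_bound[OF WV(3) F(1) _ WV(2)] dv16 by (simp add: w_def)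
  moreover have "0 \<le> w ^ 3" "0 < m ^ 3" using wm m by auto
  ultimately show False using FW by linarith
qed

section \<open>Disjoint copies\<close>

text \<open>Only the union of the vertex sets of the \<open>k\<close> disjoint copies is recorded,
  since it is this union that is deleted later.\<close>

inductive packing :: "'a set set \<Rightarrow> nat \<Rightarrow> 'a set \<Rightarrow> bool" for E where
  empty: "packing E 0 {}"
| add: "packing E k U \<Longrightarrow> f5set E X \<Longrightarrow> X \<inter> U = {} \<Longrightarrow> packing E (Suc k) (U \<union> X)"

lemma f5setI:
  assumes "distinct [a, b, c, d, e]" "{a, b, c} \<in> E" "{a, b, d} \<in> E" "{c, d, e} \<in> E"
  shows "f5set E {a, b, c, d, e}"
  unfolding f5set_def by (intro exI[of _ a] exI[of _ b] exI[of _ c] exI[of _ d] exI[of _ e] conjI refl assms)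

lemma f5setE:
  assumes "f5set E X"
  obtains a b c d e where "X = {a, b, c, d, e}" "distinct [a, b, c, d, e]"
    "{a, b, c} \<in> E" "{a, b, d} \<in> E" "{c, d, e} \<in> E"
  using assms unfolding f5set_def by auto

lemma f5set_card: "f5set E X \<Longrightarrow> card X = 5"
  by (erule f5setE) simp

lemma f5set_finite: "f5set E X \<Longrightarrow> finite X"
  by (erule f5setE) simp

lemma f5set_subset:
  assumes "f5set E X"
  shows "X \<subseteq> \<Union>E"
proof -
  obtain a b c d e where X: "X = {a, b, c, d, e}" "{a, b, c} \<in> E" "{a, b, d} \<in> E" "{c, d, e} \<in> E"
    using assms by (rule f5setE)
  have "X \<subseteq> {a, b, c} \<union> {a, b, d} \<union> {c, d, e}" unfolding X(1) by auto
  also have "\<dots> \<subseteq> \<Union>E" using X(2-4) by (intro Un_least Union_upper)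
  finally show ?thesis .
qed

lemma f5set_Int_Pow_iff: "f5set (E \<inter> Pow W) X \<longleftrightarrow> f5set E X \<and> X \<subseteq> W"
proof
  assume *: "f5set (E \<inter> Pow W) X"
  then have "X \<subseteq> W" using f5set_subset[OF *] by blast
  moreover from * have "f5set E X" by (elim f5setE) (simp add: f5setI)
  ultimately show "f5set E X \<and> X \<subseteq> W" by simp
next
  assume "f5set E X \<and> X \<subseteq> W"
  then show "f5set (E \<inter> Pow W) X" by (elim conjE f5setE) (simp add: f5setI)
qed

lemma packing_finite_card: "packing E k U \<Longrightarrow> finite U \<and> card U = 5 * k"
proof (induction rule: packing.induct)
  case (add k U X)
  then show ?case using f5set_card[OF add.hyps(2)] f5set_finite[OF add.hyps(2)]
    by (auto simp: card_Un_disjoint Int_commute)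
qed simp

lemma packing_subset: "packing E k U \<Longrightarrow> U \<subseteq> \<Union>E"
proof (induction rule: packing.induct)
  case (add k U X)
  then show ?case using f5set_subset[OF add.hyps(2)] by blast
qed simp

lemma packing_Int_Pow: "packing (E \<inter> Pow W) k U \<Longrightarrow> packing E k U \<and> U \<subseteq> W"
proof (induction rule: packing.induct)
  case (add k U X)
  then show ?case using packing.add[of E k U X] by (auto simp: f5set_Int_Pow_iff)
qed (simp add: packing.empty)

lemma packing_maximal_free:
  assumes "packing E k U" "E \<subseteq> triples V" "\<nexists>U. packing E (Suc k) U"
  shows "f5_free (E \<inter> Pow (V - U))"
  unfolding f5_free_def
proof (intro allI notI)
  fix X assume "f5set (E \<inter> Pow (V - U)) X"
  then have "f5set E X" "X \<inter> U = {}" by (auto simp: f5set_Int_Pow_iff)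
  then show False using packing.add[OF assms(1)] assms(3) by blast
qed

lemma ex_maximal_packing:
  assumes "\<nexists>U. packing E (Suc t) U"
  obtains k U where "k \<le> t" "packing E k U" "\<nexists>U. packing E (Suc k) U"
proof -
  have "\<exists>k\<le>t. (\<exists>U. packing E k U) \<and> (\<nexists>U. packing E (Suc k) U)"
    using assms
  proof (induction t)
    case 0
    then show ?case using packing.empty by blast
  next
    case (Suc t)
    show ?case
    proof (cases "\<exists>U. packing E (Suc t) U")
      case True
      then show ?thesis using Suc.prems by blast
    next
      case False
      then show ?thesis using Suc.IH le_SucI by blast
    qed
  qed
  then show thesis using that by blast
qed

text \<open>The number of edges of the join of the complete triple system on \<open>t\<close>
  vertices with the balanced tripartite one on \<open>s\<close> vertices, adding one vertex of full
  degree at a time.\<close>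

fun join_size :: "nat \<Rightarrow> nat \<Rightarrow> nat" where
  "join_size s 0 = t3 s"
| "join_size s (Suc t) = join_size s t + ((s + t) choose 2)"

lemma real_choose_two: "real (n choose 2) = (real n * real n - real n) / 2"
proof -
  have "2 * (n choose 2) = n * (n - 1)"
    by (cases n) (simp_all add: choose_two)
  then have "2 * real (n choose 2) = real n * real (n - 1)"
    by (metis of_nat_mult of_nat_numeral)
  then show ?thesis by (cases n) (simp_all add: algebra_simps)
qed

lemma join_size_lower:
  "real (t3 s) + real t * ((real s * real s - real s) / 2) \<le> real (join_size s t)"
proof (induction t)
  case (Suc t)
  have "real s * real s - real s \<le> (real s + real t) * (real s + real t) - (real s + real t)"
  proof -
    have "real t \<le> real t * real t" by (cases t) auto
    moreover have "0 \<le> real s * real t" by simp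
    ultimately have "real t \<le> real t * real t + 2 * (real s * real t)" by linarith
    then show ?thesis by (simp add: algebra_simps)
  qed
  then have "(real s * real s - real s) / 2 \<le> real ((s + t) choose 2)"
    unfolding real_choose_two by simp
  moreover have "real (Suc t) * ((real s * real s - real s) / 2) =
      real t * ((real s * real s - real s) / 2) + (real s * real s - real s) / 2"
    by (simp only: of_nat_Suc distrib_right mult_1 add.commute)
  ultimately show ?case
    unfolding join_size.simps of_nat_add using add_mono[OF Suc] by (simp only: add.assoc)
qed simp

text \<open>Meant for the deletion of \<open>t\<close> disjoint copies: \<open>5 * t\<close>
  vertices, each of degree at most n^2/2, leave a system still dense enough for
  \<open>near_extremal_deg_less\<close>. With \<open>t\<close> at most n/100000 all losses fit into
  n^3/10000.\<close>

lemma deletion_density: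
  fixes n t s :: real
  assumes "0 \<le> t" "t \<le> n / 100000" "100000 \<le> n" "s = n - t"
  shows "(1/27 - 1/10000) * (n - 5 * t) ^ 3 \<le> (s ^ 3 - 3 * s - 2) / 27 - 5 * t * (n\<^sup>2 / 2)"
proof -
  have "(n - 5 * t) ^ 3 \<le> n ^ 3" using assms by (intro power_mono) auto
  moreover have "(99999/100000 * n) ^ 3 \<le> s ^ 3" using assms by (intro power_mono) auto
  then have "(99999/100000) ^ 3 * n ^ 3 \<le> s ^ 3" by (simp only: power_mult_distrib)
  moreover have "1 - 3/100000 \<le> (99999/100000 :: real) ^ 3" by (simp add: power3_eq_cube)
  then have "(1 - 3/100000) * n ^ 3 \<le> (99999/100000) ^ 3 * n ^ 3"
    using assms by (intro mult_right_mono) auto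
  moreover have "t * n\<^sup>2 \<le> (n / 100000) * n\<^sup>2" using assms by (intro mult_right_mono) auto
  then have "t * n\<^sup>2 \<le> n ^ 3 / 100000" by (simp add: power2_eq_square power3_eq_cube)
  moreover have "n * 100000 * 100000 \<le> n * n * n" using assms by (intro mult_mono) auto
  then have "n * 10000000000 \<le> n ^ 3" by (simp add: power3_eq_cube)
  moreover have "s \<le> n" using assms by simp
  ultimately show ?thesis using assms(3) by (simp add: field_simps)
qed

text \<open>To first order the left side is n^3/27 + (9/10 - 5/9) k n^2 and the right side n^3/27 +
  (1/2 - 1/9) t n^2, with coefficients 31/90 and 35/90. The degree threshold 18/100 stays below the
  break-even value 17/90. Since \<open>t\<close> is at least 1, the gap also dominates the terms
  linear in \<open>n\<close>.\<close>

lemma small_degrees_too_few_edges: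
  fixes n k t s :: real
  assumes "0 \<le> k" "k \<le> t" "1 \<le> t" "t \<le> n / 100000" "100000 \<le> n" "s = n - t"
  shows "5 * k * (18/100 * n\<^sup>2) + (n - 5 * k) ^ 3 / 27 <
    (s ^ 3 - 3 * s - 2) / 27 + t * ((s * s - s) / 2)"
proof -
  define A where "A = n ^ 3"
  define K where "K = k * n\<^sup>2"
  define T where "T = t * n\<^sup>2"
  have KT: "0 \<le> K" "K \<le> T" using assms by (auto simp: K_def T_def mult_right_mono)
  have "k * k * n \<le> k * (n / 100000) * n" using assms by (intro mult_mono) auto
  then have kk: "k * k * n \<le> K / 100000" by (simp add: K_def power2_eq_square)
  have "t * t * n \<le> t * (n / 100000) * n" using assms by (intro mult_mono) auto
  then have tt: "t * t * n \<le> T / 100000" by (simp add: T_def power2_eq_square)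
  have "t * (n * 100000) \<le> t * (n * n)" using assms by (intro mult_left_mono) auto
  then have tn: "t * n \<le> T / 100000" by (simp add: T_def power2_eq_square)
  have "1 * n \<le> t * n" using assms by (intro mult_right_mono) auto
  then have n: "n \<le> T / 100000" using tn by simp
  have "(n - 5 * k) ^ 3 = A - 15 * K + 75 * (k * k * n) - 125 * (k * k * k)"
    by (simp add: A_def K_def power2_eq_square power3_eq_cube algebra_simps)
  moreover have "0 \<le> k * k * k" using assms by simp
  ultimately have l: "(n - 5 * k) ^ 3 \<le> A - 15 * K + 75 * (K / 100000)" using kk by linarith
  have "s ^ 3 = A - 3 * T + (3 * (t * t * n) - t * t * t)"
    by (simp add: assms(6) A_def T_def power2_eq_square power3_eq_cube algebra_simps)
  moreover have "t * t * t \<le> t * t * n" using assms by (intro mult_left_mono) auto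
  moreover have "0 \<le> t * t * n" using assms by simp
  ultimately have r: "A - 3 * T \<le> s ^ 3" by linarith
  have "t * (s * s - s) = T - 2 * (t * t * n) + t * t * t - t * n + t * t"
    by (simp add: assms(6) T_def power2_eq_square power3_eq_cube algebra_simps)
  moreover have "0 \<le> t * t * t" "0 \<le> t * t" using assms by auto
  ultimately have r2: "T - 2 * (T / 100000) - T / 100000 \<le> t * (s * s - s)" using tt tn by linarith
  have "5 * k * (18/100 * n\<^sup>2) = 9/10 * K" by (simp add: K_def)
  moreover have "3 * s + 2 \<le> 5 * n" using assms by simp
  moreover have "0 < T" using n assms by simp
  ultimately show ?thesis using l r r2 KT n by (simp add: field_simps)
qed

text \<open>Full degree puts all triples through \<open>v\<close> into \<open>E\<close>, so
  \<open>v\<close> may take colour 3.\<close>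

lemma join_model_add_vertex:
  assumes fin: "finite V" and E: "E \<subseteq> triples V" and v: "v \<in> V"
    and model: "join_model t s (V - {v}) (E \<inter> Pow (V - {v}))"
    and d: "deg E v = (card V - 1) choose 2"
  shows "join_model (Suc t) s V E"
proof -
  have "{e \<in> E. v \<in> e} = {e \<in> triples V. v \<in> e}"
  proof (rule card_seteq)
    show "card {e \<in> triples V. v \<in> e} \<le> card {e \<in> E. v \<in> e}"
      using deg_le_choose[OF fin order_refl, of v] d by (simp add: deg_def)
  qed (use finite_triples[OF fin] E in auto)
  then have all: "e \<in> E" if "e \<in> triples V" "v \<in> e" for e using that by blast
  obtain \<kappa> :: "'a \<Rightarrow> nat" where \<kappa>: "\<kappa> ` (V - {v}) \<subseteq> {..3}" "card {x \<in> V - {v}. \<kappa> x = 3} = t"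
      "\<And>i. i < 3 \<Longrightarrow> card {x \<in> V - {v}. \<kappa> x = i} = (s + i) div 3"
      "E \<inter> Pow (V - {v}) = {e \<in> triples (V - {v}). 3 \<in> \<kappa> ` e \<or> inj_on \<kappa> e}"
    using model unfolding join_model_def by blast
  define \<kappa>' where "\<kappa>' = \<kappa>(v := 3)"
  have "{x \<in> V. \<kappa>' x = 3} = insert v {x \<in> V - {v}. \<kappa> x = 3}" using v by (auto simp: \<kappa>'_def)
  then have "card {x \<in> V. \<kappa>' x = 3} = Suc t" using \<kappa>(2) fin by simp
  moreover have "{x \<in> V. \<kappa>' x = i} = {x \<in> V - {v}. \<kappa> x = i}" if "i < 3" for i
    using that by (auto simp: \<kappa>'_def)
  moreover have "\<kappa>' ` V \<subseteq> {..3}" using \<kappa>(1) by (auto simp: \<kappa>'_def)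
  moreover have "E = {e \<in> triples V. 3 \<in> \<kappa>' ` e \<or> inj_on \<kappa>' e}"
  proof -
    have "e \<in> E \<longleftrightarrow> 3 \<in> \<kappa>' ` e \<or> inj_on \<kappa>' e" if e: "e \<in> triples V" for e
    proof (cases "v \<in> e")
      case True
      then have "3 \<in> \<kappa>' ` e" by (auto simp: \<kappa>'_def image_iff)
      then show ?thesis using all[OF e True] by simp
    next
      case False
      then have "e \<in> triples (V - {v})" using e by (auto simp: triples_def)
      then have "e \<in> E \<longleftrightarrow> 3 \<in> \<kappa> ` e \<or> inj_on \<kappa> e" using \<kappa>(4) by (auto simp: triples_def)
      moreover have "\<kappa>' x = \<kappa> x" if "x \<in> e" for x using False that by (auto simp: \<kappa>'_def)
      then have "\<kappa>' ` e = \<kappa> ` e" "inj_on \<kappa>' e = inj_on \<kappa> e"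
        using inj_on_cong[of e \<kappa>' \<kappa>] by auto
      ultimately show ?thesis by simp
    qed
    then show ?thesis using E by blast
  qed
  ultimately show ?thesis unfolding join_model_def using \<kappa>(3) by (intro exI[of _ \<kappa>']) simp
qed

text \<open>The induction keeps \<open>s\<close> fixed and lowers \<open>t\<close> together with the
  number of vertices, so the tripartite part of the model is the same throughout and each step adds
  one vertex of colour 3.\<close>

lemma packing_free_bound:
  assumes "finite V" "E \<subseteq> triples V" "card V = s + t" "20 * exact_from \<le> s"
    and "real t \<le> real (s + t) / 100000" "\<nexists>U. packing E (Suc t) U"
  shows "card E \<le> join_size s t \<and> (card E = join_size s t \<longrightarrow> join_model t s V E)"
  using assms
proof (induction t arbitrary: V E)
  case 0
  have "E \<inter> Pow (V - {}) = E" using 0(2) by (auto simp: triples_def)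
  then have free: "f5_free E"
    using packing_maximal_free[OF packing.empty 0(2,6)] by simp
  have "exact_from < card V" using 0 exact_from_ge by simp
  then show ?case
    using f5_free_card_le[OF 0(1,2) free] f5_free_extremal[OF 0(1,2) free] 0(3) by simp
next
  case (Suc t)
  note fin = Suc.prems(1) and E = Suc.prems(2)
  define n where "n = real (card V)"
  define \<tau> where "\<tau> = real (Suc t)"
  have n: "n = real s + \<tau>" unfolding n_def \<tau>_def using Suc.prems(3) by simp
  have s: "real s \<ge> 20 * real exact_from"
    using of_nat_mono[OF Suc.prems(4), where 'a = real] by simp
  have n5: "n \<ge> 100000" using s n exact_from_ge by (simp add: \<tau>_def)
  have \<tau>: "1 \<le> \<tau>" "\<tau> \<le> n / 100000" "0 \<le> \<tau>" using Suc.prems(5) n by (auto simp: \<tau>_def)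
  have lower: "(real s ^ 3 - 3 * real s - 2) / 27 + \<tau> * ((real s * real s - real s) / 2) \<le> real (join_size s (Suc t))"
  proof -
    have *: "(x - 3 * b - 2) / 27 + y \<le> z" if "x \<le> 27 * a + 3 * b + 2" "a + y \<le> z" for a b x y z :: real
      using that by (simp add: field_simps)
    show ?thesis by (rule *[OF t3_lower join_size_lower[of s "Suc t", folded \<tau>_def]])
  qed
  have s1: "0 \<le> real s * real s - real s" by (cases s) auto
  have lower0: "(real s ^ 3 - 3 * real s - 2) / 27 \<le> real (join_size s (Suc t))"
    using order_trans[OF _ lower] mult_nonneg_nonneg[OF \<tau>(3), of "(real s * real s - real s) / 2"] s1
    by (simp only: le_add_same_cancel1 divide_nonneg_nonneg zero_le_numeral)
  show ?case
  proof (cases "card E < join_size s (Suc t)")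
    case False
    then have big: "real (join_size s (Suc t)) \<le> real (card E)" by simp
    have degs: "real (deg E u) \<le> n\<^sup>2 / 2" for u
    proof -
      have "deg E u \<le> (card V - 1) choose 2" by (rule deg_le_choose[OF fin E])
      also have "\<dots> \<le> card V choose 2" by (rule binomial_right_mono) simp
      finally have "real (deg E u) \<le> (n * n - n) / 2" unfolding n_def real_choose_two[symmetric] by simp
      then show ?thesis using n5 by (simp add: power2_eq_square)
    qed
    \<comment> \<open>What remains after deleting a packing of at most \<open>Suc t\<close> copies.
      The factor 20 in the bound on \<open>s\<close> leaves the \<open>10 * exact_from\<close>
      vertices that \<open>near_extremal_deg_less\<close> asks for.\<close>
    have rest: "real (card (V - U)) = n - 5 * real k" "exact_from * 10 \<le> card (V - U)"
      "real (card E) \<le> (\<Sum>u\<in>U. real (deg E u)) + real (card (E \<inter> Pow (V - U)))"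
      "E \<inter> Pow (V - U) \<subseteq> triples (V - U)" "U \<subseteq> V" "card U = 5 * k"
      if U: "packing E k U" "k \<le> Suc t" for k U
    proof -
      show UV: "U \<subseteq> V" using packing_subset[OF U(1)] edgeD[OF E] by blast
      have c: "finite U" "card U = 5 * k" using packing_finite_card[OF U(1)] by auto
      then show "card U = 5 * k" by simp
      have cV: "card U \<le> card V" using card_mono[OF fin UV] .
      show r: "real (card (V - U)) = n - 5 * real k"
        using c UV cV by (simp add: card_Diff_subset n_def of_nat_diff)
      have "real k \<le> \<tau>" using U(2) unfolding \<tau>_def by simp
      then have "real (exact_from * 10) \<le> real (card (V - U))" unfolding r using \<tau> n s by simp
      then show "exact_from * 10 \<le> card (V - U)" by (simp only: of_nat_le_iff)
      show "real (card E) \<le> (\<Sum>u\<in>U. real (deg E u)) + real (card (E \<inter> Pow (V - U)))"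
        using card_le_sum_deg[OF fin E UV] by (metis of_nat_add of_nat_le_iff of_nat_sum)
      show "E \<inter> Pow (V - U) \<subseteq> triples (V - U)" using E by (auto simp: triples_def)
    qed
    show ?thesis
    proof (cases "\<exists>v\<in>V. 18/100 * n\<^sup>2 \<le> real (deg E v)")
      case True
      then obtain v where v: "v \<in> V" "18/100 * n\<^sup>2 \<le> real (deg E v)" by blast
      have no: "\<nexists>U. packing (E \<inter> Pow (V - {v})) (Suc t) U"
      proof
        assume "\<exists>U. packing (E \<inter> Pow (V - {v})) (Suc t) U"
        then obtain U where U: "packing E (Suc t) U" "U \<subseteq> V - {v}" using packing_Int_Pow by blast
        note R = rest[OF U(1) order_refl, folded \<tau>_def]
        define F where "F = E \<inter> Pow (V - U)"
        have free: "f5_free F" unfolding F_def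
          by (rule packing_maximal_free[OF U(1) E Suc.prems(6)])
        have "(\<Sum>u\<in>U. real (deg E u)) \<le> (\<Sum>u\<in>U. n\<^sup>2 / 2)" by (rule sum_mono) (rule degs)
        also have "\<dots> = 5 * \<tau> * (n\<^sup>2 / 2)" using R(6) by (simp add: \<tau>_def)
        finally have "(1/27 - 1/10000) * (n - 5 * \<tau>) ^ 3 \<le> real (card F)"
          using deletion_density[of \<tau> n "real s"] \<tau> n5 n lower0 big R(3) unfolding F_def by linarith
        then have "real (deg F v) < 175/1000 * (n - 5 * \<tau>)\<^sup>2"
          using near_extremal_deg_less[of "V - U" F v] R fin free v U(2) unfolding F_def by auto
        also have "\<dots> \<le> 175/1000 * n\<^sup>2" using \<tau> n5 by (intro mult_left_mono power_mono) auto
        finally have "real (deg F v) < 175/1000 * n\<^sup>2" .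
        \<comment> \<open>Deleting \<open>U\<close> costs \<open>v\<close> at most 5 n^2/100000
          edges, far less than the gap between 18/100 and 175/1000.\<close>
        moreover have "deg E v \<le> deg F v + card U * card V"
          using deg_le_deg_remove[OF fin E R(5), of v] U(2) unfolding F_def by blast
        then have "real (deg E v) \<le> real (deg F v) + real (card U) * n"
          unfolding n_def by (metis of_nat_add of_nat_le_iff of_nat_mult)
        moreover have "real (card U) = 5 * \<tau>" using R(6) by (simp add: \<tau>_def)
        moreover have "\<tau> * n \<le> (n / 100000) * n" using \<tau> n5 by (intro mult_right_mono) auto
        moreover have "0 < n * n" using n5 by simp
        ultimately show False using v(2) by (simp add: power2_eq_square)
      qed
      define E' where "E' = E \<inter> Pow (V - {v})"
      have c: "card (V - {v}) = s + t" using v fin Suc.prems(3) by simp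
      have "card E' \<le> join_size s t \<and> (card E' = join_size s t \<longrightarrow> join_model t s (V - {v}) E')"
      proof (rule Suc.IH)
        show "real t \<le> real (s + t) / 100000" using Suc.prems(5) by simp
        show "E' \<subseteq> triples (V - {v})" using E by (auto simp: E'_def triples_def)
      qed (use fin c Suc.prems(4) no in \<open>auto simp: E'_def\<close>)
      moreover have d: "deg E v \<le> (s + t) choose 2"
        using deg_le_choose[OF fin E, of v] Suc.prems(3) by simp
      moreover have "card E = deg E v + card E'"
        unfolding E'_def by (rule card_eq_deg_plus[OF fin E])
      \<comment> \<open>Both summands are bounded by those of \<open>join_size s (Suc t)\<close>, so
        equality of the sums gives a vertex of full degree and an extremal remainder.\<close>
      ultimately show ?thesis
        using join_model_add_vertex[OF fin E v(1), of t s] Suc.prems(3) by (auto simp: E'_def)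
    next
      case small: False
      \<comment> \<open>The maximal packing may have fewer than \<open>Suc t\<close> copies, hence
        the separate parameter \<open>k\<close> in
        \<open>small_degrees_too_few_edges\<close>.\<close>
      obtain k U where k: "k \<le> Suc t" and U: "packing E k U" and max: "\<nexists>U. packing E (Suc k) U"
        using ex_maximal_packing[OF Suc.prems(6)] .
      note R = rest[OF U k]
      define F where "F = E \<inter> Pow (V - U)"
      have "card F \<le> t3 (card (V - U))"
        unfolding F_def
        by (rule f5_free_card_le[OF _ R(4) packing_maximal_free[OF U E max]]) (use fin R(2) in auto)
      then have F: "real (card F) \<le> (n - 5 * real k) ^ 3 / 27"
        using t3_upper[of "card (V - U)"] R(1) of_nat_mono[where 'a = real] by fastforce
      have "(\<Sum>u\<in>U. real (deg E u)) \<le> (\<Sum>u\<in>U. 18/100 * n\<^sup>2)"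
        using small R(5) by (intro sum_mono) (meson less_imp_le not_le subsetD)
      also have "\<dots> = 5 * real k * (18/100 * n\<^sup>2)" using R(6) by simp
      finally have "real (card E) \<le> 5 * real k * (18/100 * n\<^sup>2) + (n - 5 * real k) ^ 3 / 27"
        using R(3) F unfolding F_def by linarith
      also have "\<dots> < (real s ^ 3 - 3 * real s - 2) / 27 + \<tau> * ((real s * real s - real s) / 2)"
        by (rule small_degrees_too_few_edges) (use k \<tau> n5 n in \<open>auto simp: \<tau>_def\<close>)
      finally have False using lower big by linarith
      then show ?thesis ..
    qed
  qed simp
qed

section \<open>Isomorphism with the join\<close>

text \<open>\<open>rgraph\<close> keeps the edges inside the vertex set, where the inverse map
  undoes \<open>f\<close>.\<close>

lemma hiso_sym:
  assumes "G \<simeq> H" "rgraph r G"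
  shows "H \<simeq> G"
proof -
  obtain f where f: "bij_betw f (verts G) (verts H)" "(\<lambda>e. f ` e) ` edges G = edges H"
    using assms(1) by (auto simp: hiso_def)
  let ?g = "inv_into (verts G) f"
  have "?g ` f ` e = e" if "e \<in> edges G" for e
    using that f(1) assms(2) by (intro inv_into_image_cancel) (auto simp: bij_betw_def rgraph_def)
  then have "(\<lambda>e. ?g ` e) ` edges H = edges G" unfolding f(2)[symmetric] image_image by simp
  then show ?thesis unfolding hiso_def using bij_betw_inv_into[OF f(1)] by blast
qed

lemma hiso_trans:
  assumes "G \<simeq> H" "H \<simeq> K"
  shows "G \<simeq> K"
proof -
  obtain f where f: "bij_betw f (verts G) (verts H)" "(\<lambda>e. f ` e) ` edges G = edges H"
    using assms(1) by (auto simp: hiso_def)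
  obtain g where g: "bij_betw g (verts H) (verts K)" "(\<lambda>e. g ` e) ` edges H = edges K"
    using assms(2) by (auto simp: hiso_def)
  have "(\<lambda>e. (g \<circ> f) ` e) ` edges G = edges K"
    unfolding g(2)[symmetric] f(2)[symmetric] by (simp add: image_image image_comp)
  then show ?thesis unfolding hiso_def using bij_betw_trans[OF f(1) g(1)] by blast
qed

lemma iso_class_eq:
  assumes "G \<simeq> H" "rgraph r G"
  shows "iso_class G = iso_class H"
  unfolding iso_class_def
proof (intro Collect_cong iffI)
  show "H \<simeq> K" if "G \<simeq> K" for K :: "nat hypergraph"
    using hiso_sym[OF assms] that by (rule hiso_trans)
  show "G \<simeq> K" if "H \<simeq> K" for K :: "nat hypergraph"
    using assms(1) that by (rule hiso_trans)
qed

section \<open>Copies of \<open>T3\<close> and packings\<close>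

lemma verts_T3: "verts T3 = {1, 2, 3, 4, 5}"
  by (auto simp: T3_def)

lemma T3_iso_imp_f5set:
  assumes "T3 \<simeq> C"
  shows "f5set (edges C) (verts C)"
proof -
  obtain f where f: "bij_betw f {1, 2, 3, 4, 5} (verts C)" "(\<lambda>e. f ` e) ` edges T3 = edges C"
    using assms by (auto simp: hiso_def verts_T3)
  then have V: "verts C = {f 1, f 2, f 3, f 4, f 5}" by (auto simp: bij_betw_def)
  have "edges C = {{f 1, f 2, f 3}, {f 1, f 2, f 4}, {f 3, f 4, f 5}}"
    unfolding f(2)[symmetric] by (simp add: T3_def)
  moreover have "distinct [f 1, f 2, f 3, f 4, f 5]"
    using f(1) by (auto simp: bij_betw_def inj_on_def)
  ultimately show ?thesis unfolding V by (intro f5setI) auto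
qed

lemma f5set_imp_T3_iso:
  assumes "f5set E X"
  obtains C where "verts C = X" "edges C \<subseteq> E" "T3 \<simeq> C"
proof -
  obtain a b c d e where X: "X = {a, b, c, d, e}" "distinct [a, b, c, d, e]"
    and E: "{a, b, c} \<in> E" "{a, b, d} \<in> E" "{c, d, e} \<in> E"
    using assms by (rule f5setE)
  define f where "f i = [a, b, c, d, e] ! (i - 1)" for i :: nat
  have f: "f 1 = a" "f 2 = b" "f 3 = c" "f 4 = d" "f 5 = e" by (simp_all add: f_def)
  define C where "C = Hypergraph X {{a, b, c}, {a, b, d}, {c, d, e}}"
  have im: "f ` verts T3 = X" unfolding verts_T3 X(1) by (simp only: image_insert image_empty f)
  then have "card (f ` verts T3) = card (verts T3)" using f5set_card[OF assms] by (simp add: verts_T3)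
  then have "inj_on f (verts T3)" by (intro eq_card_imp_inj_on) (simp_all add: verts_T3)
  then have "bij_betw f (verts T3) (verts C)" using im by (simp add: bij_betw_def C_def)
  moreover have "(\<lambda>e. f ` e) ` edges T3 = edges C"
    unfolding T3_def C_def by (simp only: hypergraph.sel image_insert image_empty f)
  ultimately have "T3 \<simeq> C" by (auto simp: hiso_def)
  then show thesis using E by (intro that[of C]) (auto simp: C_def)
qed

lemma contains_disjoint_copies_T3_iff:
  assumes "rgraph 3 G"
  shows "contains_disjoint_copies k T3 G \<longleftrightarrow> (\<exists>U. packing (edges G) k U)"
proof
  assume "contains_disjoint_copies k T3 G"
  then obtain C :: "nat \<Rightarrow> 'a hypergraph" where
    C: "\<And>i. i < k \<Longrightarrow> subhypergraph (C i) G \<and> T3 \<simeq> C i"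
    and disj: "\<And>i j. i < k \<Longrightarrow> j < k \<Longrightarrow> i \<noteq> j \<Longrightarrow> verts (C i) \<inter> verts (C j) = {}"
    unfolding contains_disjoint_copies_def by blast
  have "packing (edges G) m (\<Union>i<m. verts (C i))" if "m \<le> k" for m
    using that
  proof (induction m)
    case 0
    then show ?case by (simp add: packing.empty)
  next
    case (Suc m)
    have "f5set (edges (C m)) (verts (C m))" "edges (C m) \<subseteq> edges G"
      using C[of m] Suc.prems T3_iso_imp_f5set by (auto simp: subhypergraph_def)
    then have "f5set (edges G) (verts (C m))" by (elim f5setE) (auto intro!: f5setI)
    moreover have "verts (C m) \<inter> verts (C i) = {}" if "i < m" for i
      using disj[of m i] that Suc.prems by simp
    then have "verts (C m) \<inter> (\<Union>i<m. verts (C i)) = {}" by blast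
    ultimately have "packing (edges G) (Suc m) ((\<Union>i<m. verts (C i)) \<union> verts (C m))"
      using Suc by (intro packing.add) auto
    then show ?case by (simp add: lessThan_Suc Un_commute)
  qed
  then show "\<exists>U. packing (edges G) k U" by blast
next
  assume "\<exists>U. packing (edges G) k U"
  then obtain U where "packing (edges G) k U" by blast
  \<comment> \<open>The inclusion in \<open>U\<close> is carried through the induction because it
    makes the next copy disjoint from all earlier ones.\<close>
  then have "\<exists>C :: nat \<Rightarrow> 'a hypergraph. (\<forall>i<k. subhypergraph (C i) G \<and> T3 \<simeq> C i) \<and>
      (\<forall>i<k. \<forall>j<k. i \<noteq> j \<longrightarrow> verts (C i) \<inter> verts (C j) = {}) \<and> (\<forall>i<k. verts (C i) \<subseteq> U)"
  proof (induction rule: packing.induct)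
    case (add k U X)
    from add.IH obtain C :: "nat \<Rightarrow> 'a hypergraph" where
      C: "\<forall>i<k. subhypergraph (C i) G \<and> T3 \<simeq> C i" "\<forall>i<k. verts (C i) \<subseteq> U"
      and disj: "\<forall>i<k. \<forall>j<k. i \<noteq> j \<longrightarrow> verts (C i) \<inter> verts (C j) = {}"
      by (elim exE conjE)
    obtain D where D: "verts D = X" "edges D \<subseteq> edges G" "T3 \<simeq> D"
      using f5set_imp_T3_iso[OF add.hyps(2)] .
    have "X \<subseteq> verts G" using f5set_subset[OF add.hyps(2)] assms by (auto simp: rgraph_def)
    then have DG: "subhypergraph D G" using D by (simp add: subhypergraph_def)
    have XC: "verts (C i) \<inter> X = {}" "X \<inter> verts (C i) = {}" if "i < k" for i
      using C(2) that add.hyps(3) by auto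
    let ?C = "C(k := D)"
    have "subhypergraph (?C i) G \<and> T3 \<simeq> ?C i" if "i < Suc k" for i
      using C(1) DG D(3) that by (auto simp: less_Suc_eq)
    moreover have "verts (?C i) \<inter> verts (?C j) = {}" if "i < Suc k" "j < Suc k" "i \<noteq> j" for i j
      using disj XC D(1) that by (auto simp: less_Suc_eq)
    moreover have "verts (?C i) \<subseteq> U \<union> X" if "i < Suc k" for i
      using C(2) D(1) that by (auto simp: less_Suc_eq)
    ultimately show ?case by (intro exI[of _ ?C]) simp
  qed auto
  then show "contains_disjoint_copies k T3 G"
    unfolding contains_disjoint_copies_def by blast
qed

section \<open>Size, packing number and uniqueness of the extremal model\<close>

lemma join_model_subset: "join_model t s V E \<Longrightarrow> E \<subseteq> triples V"
  by (auto simp: join_model_def)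

lemma sum_div_3: "s div 3 + (s + 1) div 3 + (s + 2) div 3 = (s :: nat)"
proof (induction s)
  case (Suc s)
  have "(Suc s + 2) div 3 = s div 3 + 1" "(Suc s + 1) div 3 = (s + 2) div 3" "Suc s div 3 = (s + 1) div 3"
    by simp_all
  then show ?case using Suc by linarith
qed simp

lemma join_model_card_verts:
  assumes "join_model t s V E" "finite V"
  shows "card V = s + t"
proof -
  obtain \<kappa> :: "'a \<Rightarrow> nat" where \<kappa>: "\<kappa> ` V \<subseteq> {..3}" "card {x \<in> V. \<kappa> x = 3} = t"
      "\<And>i. i < 3 \<Longrightarrow> card {x \<in> V. \<kappa> x = i} = (s + i) div 3"
    using assms(1) unfolding join_model_def by blast
  have "V = (\<Union>i\<in>{..3}. {x \<in> V. \<kappa> x = i})" using \<kappa>(1) by auto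
  then have "card V = (\<Sum>i\<in>{..3}. card {x \<in> V. \<kappa> x = i})"
    using card_UN_disjoint[of "{..3}" "\<lambda>i. {x \<in> V. \<kappa> x = i}"] assms(2) by auto
  also have "{..3::nat} = {0, 1, 2, 3}" by auto
  finally have "card V = s div 3 + (s + 1) div 3 + (s + 2) div 3 + t"
    using \<kappa>(2) \<kappa>(3)[of 0] \<kappa>(3)[of 1] \<kappa>(3)[of 2] by simp
  also have "\<dots> = s + t" by (simp only: sum_div_3)
  finally show ?thesis .
qed

lemma deg_triples:
  assumes "finite V" "v \<in> V"
  shows "deg (triples V) v = (card V - 1) choose 2"
proof -
  have "triples V \<inter> Pow (V - {v}) = triples (V - {v})" by (auto simp: triples_def)
  then have "card V choose 3 = deg (triples V) v + ((card V - 1) choose 3)"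
    using card_eq_deg_plus[OF assms(1) order_refl, of v] assms by (simp add: card_triples)
  moreover obtain n where "card V = Suc n" using assms by (metis card_Suc_Diff1)
  ultimately show ?thesis by (simp add: numeral_3_eq_3 numeral_2_eq_2)
qed

text \<open>The vertices of colour 3 have full degree and are removed one by one, following the
  recursion of \<open>join_size\<close>; without them the edges are the transversals of the three
  parts.\<close>

lemma join_model_card_edges:
  assumes "join_model t s V E" "finite V"
  shows "card E = join_size s t"
  using assms
proof (induction t arbitrary: V E)
  case 0
  then obtain \<kappa> :: "'a \<Rightarrow> nat" where \<kappa>: "\<kappa> ` V \<subseteq> {..3}" "{x \<in> V. \<kappa> x = 3} = {}"
      "\<And>i. i < 3 \<Longrightarrow> card {x \<in> V. \<kappa> x = i} = (s + i) div 3"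
      "E = {e \<in> triples V. 3 \<in> \<kappa> ` e \<or> inj_on \<kappa> e}"
    unfolding join_model_def by auto
  have \<kappa>3: "\<kappa> ` V \<subseteq> {..<3}"
  proof clarify
    fix v assume "v \<in> V"
    then have "\<kappa> v \<le> 3" "\<kappa> v \<noteq> 3" using \<kappa>(1,2) by auto
    then show "\<kappa> v < 3" by simp
  qed
  then have "E = {e \<in> triples V. inj_on \<kappa> e}"
    unfolding \<kappa>(4) by (fastforce simp: triples_def)
  then show ?case
    using card_transversals[OF 0(2) \<kappa>3] \<kappa>(3)[of 0] \<kappa>(3)[of 1] \<kappa>(3)[of 2] by (simp add: t3_def)
next
  case (Suc t)
  then obtain \<kappa> :: "'a \<Rightarrow> nat" where \<kappa>: "\<kappa> ` V \<subseteq> {..3}" "card {x \<in> V. \<kappa> x = 3} = Suc t"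
      "\<And>i. i < 3 \<Longrightarrow> card {x \<in> V. \<kappa> x = i} = (s + i) div 3"
      "E = {e \<in> triples V. 3 \<in> \<kappa> ` e \<or> inj_on \<kappa> e}"
    unfolding join_model_def by blast
  then have "{x \<in> V. \<kappa> x = 3} \<noteq> {}" by (metis card.empty nat.distinct(1))
  then obtain v where v: "v \<in> V" "\<kappa> v = 3" by blast
  have "{x \<in> V - {v}. \<kappa> x = 3} = {x \<in> V. \<kappa> x = 3} - {v}" by auto
  then have "card {x \<in> V - {v}. \<kappa> x = 3} = t" using \<kappa>(2) v Suc.prems(2) by simp
  moreover have "{x \<in> V - {v}. \<kappa> x = i} = {x \<in> V. \<kappa> x = i}" if "i < 3" for i using v that by auto
  ultimately have "join_model t s (V - {v}) (E \<inter> Pow (V - {v}))"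
    unfolding join_model_def using \<kappa>
    by (intro exI[of _ \<kappa>]) (auto simp: triples_def)
  then have "card (E \<inter> Pow (V - {v})) = join_size s t" using Suc by blast
  moreover have "{e \<in> E. v \<in> e} = {e \<in> triples V. v \<in> e}" using \<kappa>(4) v by force
  then have "deg E v = (s + t) choose 2"
    using deg_triples[OF Suc.prems(2) v(1)] join_model_card_verts[OF Suc.prems] by (simp add: deg_def)
  ultimately show ?case
    using card_eq_deg_plus[OF Suc.prems(2) join_model_subset[OF Suc.prems(1)], of v] by simp
qed

text \<open>Every copy of \<open>T3\<close> uses a vertex of colour 3, and there are only
  \<open>t\<close> of these. In a copy without one, \<open>a\<close>, \<open>b\<close>,
  \<open>c\<close>, \<open>d\<close> would have pairwise different colours among three, where
  \<open>c\<close> and \<open>d\<close> differ because of the edge \<open>cde\<close>.\<close>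

lemma join_model_no_packing:
  assumes "join_model t s V E" "finite V"
  shows "\<not> packing E (Suc t) U"
proof -
  obtain \<kappa> :: "'a \<Rightarrow> nat" where \<kappa>: "\<kappa> ` V \<subseteq> {..3}" "card {x \<in> V. \<kappa> x = 3} = t"
      "E = {e \<in> triples V. 3 \<in> \<kappa> ` e \<or> inj_on \<kappa> e}"
    using assms(1) unfolding join_model_def by blast
  define S where "S = {x \<in> V. \<kappa> x = 3}"
  have finS: "finite S" using assms(2) by (simp add: S_def)
  have meet: "X \<inter> S \<noteq> {}" if f5: "f5set E X" for X
  proof
    assume XS: "X \<inter> S = {}"
    obtain a b c d e where X: "X = {a, b, c, d, e}" "distinct [a, b, c, d, e]"
      and E: "{a, b, c} \<in> E" "{a, b, d} \<in> E" "{c, d, e} \<in> E"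
      using f5 by (rule f5setE)
    have "a \<in> V" "b \<in> V" "c \<in> V" "d \<in> V" "e \<in> V" using E \<kappa>(3) by (auto simp: triples_def)
    then have less: "\<kappa> a \<le> 3" "\<kappa> b \<le> 3" "\<kappa> c \<le> 3" "\<kappa> d \<le> 3"
      and no3: "\<kappa> a \<noteq> 3" "\<kappa> b \<noteq> 3" "\<kappa> c \<noteq> 3" "\<kappa> d \<noteq> 3" "\<kappa> e \<noteq> 3"
      using \<kappa>(1) XS X(1) by (auto simp: S_def)
    have "inj_on \<kappa> {a, b, c}" "inj_on \<kappa> {a, b, d}" "inj_on \<kappa> {c, d, e}"
      using E no3 unfolding \<kappa>(3) by auto
    then have "\<kappa> a \<noteq> \<kappa> b" "\<kappa> a \<noteq> \<kappa> c" "\<kappa> b \<noteq> \<kappa> c" "\<kappa> a \<noteq> \<kappa> d" "\<kappa> b \<noteq> \<kappa> d" "\<kappa> c \<noteq> \<kappa> d"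
      using X(2) by (auto simp: inj_on_def)
    then show False using less no3 by presburger
  qed
  have "packing E k U \<Longrightarrow> k \<le> card (U \<inter> S)" for k U
  proof (induction rule: packing.induct)
    case (add k U X)
    have "card ((U \<union> X) \<inter> S) = card (U \<inter> S) + card (X \<inter> S)"
      using add.hyps(3) finS by (subst card_Un_disjoint[symmetric]) (auto simp: Int_Un_distrib2)
    moreover have "card (X \<inter> S) > 0" using meet[OF add.hyps(2)] finS by (simp add: card_gt_0_iff)
    ultimately show ?case using add.IH by simp
  qed simp
  moreover have "card (U \<inter> S) \<le> t" using card_mono[of S "U \<inter> S"] finS \<kappa>(2) by (simp add: S_def)
  ultimately show ?thesis by fastforce
qed

text \<open>The class sizes are prescribed and the edges depend on the colours alone, so bijections
  between corresponding classes glue to an isomorphism. The vertex types may differ because the join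
  lives on a sum type.\<close>

lemma join_model_unique:
  fixes V :: "'a set" and V' :: "'b set"
  assumes m: "join_model t s V E" "finite V" and m': "join_model t s V' E'" "finite V'"
  shows "Hypergraph V E \<simeq> Hypergraph V' E'"
proof -
  obtain \<kappa> :: "'a \<Rightarrow> nat" where \<kappa>: "\<kappa> ` V \<subseteq> {..3}" "card {x \<in> V. \<kappa> x = 3} = t"
      "\<And>i. i < 3 \<Longrightarrow> card {x \<in> V. \<kappa> x = i} = (s + i) div 3"
      "E = {e \<in> triples V. 3 \<in> \<kappa> ` e \<or> inj_on \<kappa> e}"
    using m(1) unfolding join_model_def by blast
  obtain \<kappa>' :: "'b \<Rightarrow> nat" where \<kappa>': "\<kappa>' ` V' \<subseteq> {..3}" "card {x \<in> V'. \<kappa>' x = 3} = t"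
      "\<And>i. i < 3 \<Longrightarrow> card {x \<in> V'. \<kappa>' x = i} = (s + i) div 3"
      "E' = {e \<in> triples V'. 3 \<in> \<kappa>' ` e \<or> inj_on \<kappa>' e}"
    using m'(1) unfolding join_model_def by blast
  have "\<exists>g. bij_betw g {x \<in> V. \<kappa> x = i} {x \<in> V'. \<kappa>' x = i}" if "i \<le> 3" for i
  proof (rule finite_same_card_bij)
    show "card {x \<in> V. \<kappa> x = i} = card {x \<in> V'. \<kappa>' x = i}"
      using that \<kappa>(2,3) \<kappa>'(2,3) by (cases "i = 3") auto
  qed (use m m' in auto)
  then obtain g where g: "\<And>i. i \<le> 3 \<Longrightarrow> bij_betw (g i) {x \<in> V. \<kappa> x = i} {x \<in> V'. \<kappa>' x = i}"
    by metis
  define f where "f v = g (\<kappa> v) v" for v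
  have le3: "\<kappa> v \<le> 3" if "v \<in> V" for v using that \<kappa>(1) by auto
  have fV: "f v \<in> V'" "\<kappa>' (f v) = \<kappa> v" if "v \<in> V" for v
    using bij_betwE[OF g[OF le3[OF that]]] that by (auto simp: f_def)
  have inj: "inj_on f V"
  proof (rule inj_onI)
    fix v w assume vw: "v \<in> V" "w \<in> V" "f v = f w"
    then have "\<kappa> v = \<kappa> w" using fV by metis
    then show "v = w" using vw g[OF le3[OF vw(1)]] by (auto simp: f_def bij_betw_def inj_on_def)
  qed
  have surj: "f ` V = V'"
  proof
    show "f ` V \<subseteq> V'" using fV by auto
    show "V' \<subseteq> f ` V"
    proof
      fix y assume y: "y \<in> V'"
      then have "\<kappa>' y \<le> 3" using \<kappa>'(1) by auto
      then have "y \<in> g (\<kappa>' y) ` {x \<in> V. \<kappa> x = \<kappa>' y}"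
        using g[of "\<kappa>' y"] y by (auto simp: bij_betw_def)
      then obtain x where "y = g (\<kappa>' y) x" "x \<in> V" "\<kappa> x = \<kappa>' y" by blast
      then have "y = f x" "x \<in> V" by (simp_all add: f_def)
      then show "y \<in> f ` V" by blast
    qed
  qed
  have edge: "f ` e \<in> E' \<longleftrightarrow> e \<in> E" if e: "e \<subseteq> V" for e
  proof -
    have i: "inj_on f e" using inj e inj_on_subset by blast
    have "f ` e \<in> triples V' \<longleftrightarrow> e \<in> triples V"
      using e surj card_image[OF i] by (auto simp: triples_def)
    moreover have "\<kappa>' ` f ` e = \<kappa> ` e" using fV e by (force simp: image_image)
    moreover have "inj_on \<kappa>' (f ` e) \<longleftrightarrow> inj_on \<kappa> e"
      unfolding comp_inj_on_iff[OF i] using fV e by (intro inj_on_cong) auto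
    ultimately show ?thesis unfolding \<kappa>(4) \<kappa>'(4) by simp
  qed
  have "(\<lambda>e. f ` e) ` E = E'"
  proof
    show "(\<lambda>e. f ` e) ` E \<subseteq> E'" using edge join_model_subset[OF m(1)] by (auto simp: triples_def)
    show "E' \<subseteq> (\<lambda>e. f ` e) ` E"
    proof
      fix e' assume e': "e' \<in> E'"
      then have "e' \<subseteq> f ` V" using join_model_subset[OF m'(1)] surj by (auto simp: triples_def)
      then obtain e where "e \<subseteq> V" "e' = f ` e" by (meson subset_imageE)
      then show "e' \<in> (\<lambda>e. f ` e) ` E" using edge e' by blast
    qed
  qed
  then show ?thesis unfolding hiso_def using inj surj by (auto simp: bij_betw_def)
qed

text \<open>Used to carry the join from a sum type to the naturals, where
  \<open>free_rgraphs\<close> lives.\<close>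

lemma join_model_image:
  assumes "join_model t s V E" "inj h"
  shows "join_model t s (h ` V) ((\<lambda>e. h ` e) ` E)"
proof -
  obtain \<kappa> :: "'a \<Rightarrow> nat" where \<kappa>: "\<kappa> ` V \<subseteq> {..3}" "card {x \<in> V. \<kappa> x = 3} = t"
      "\<And>i. i < 3 \<Longrightarrow> card {x \<in> V. \<kappa> x = i} = (s + i) div 3"
      "E = {e \<in> triples V. 3 \<in> \<kappa> ` e \<or> inj_on \<kappa> e}"
    using assms(1) unfolding join_model_def by blast
  define \<kappa>' where "\<kappa>' = \<kappa> \<circ> inv h"
  have \<kappa>'h: "\<kappa>' (h x) = \<kappa> x" for x using assms(2) by (simp add: \<kappa>'_def)
  have "card {y \<in> h ` V. \<kappa>' y = i} = card {x \<in> V. \<kappa> x = i}" for i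
  proof -
    have "{y \<in> h ` V. \<kappa>' y = i} = h ` {x \<in> V. \<kappa> x = i}" using \<kappa>'h by auto
    then show ?thesis using assms(2) by (simp add: card_image inj_on_subset)
  qed
  moreover have "h ` e \<in> triples (h ` V) \<and> (3 \<in> \<kappa>' ` h ` e \<or> inj_on \<kappa>' (h ` e)) \<longleftrightarrow> e \<in> E" for e
  proof -
    have i: "inj_on h e" using assms(2) inj_on_subset by blast
    have "h ` e \<in> triples (h ` V) \<longleftrightarrow> e \<in> triples V"
      using card_image[OF i] inj_image_subset_iff[OF assms(2)] by (simp add: triples_def)
    moreover have "\<kappa>' ` h ` e = \<kappa> ` e" by (simp add: image_image \<kappa>'h)
    moreover have "inj_on \<kappa>' (h ` e) \<longleftrightarrow> inj_on \<kappa> e"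
      unfolding comp_inj_on_iff[OF i] using \<kappa>'h by (intro inj_on_cong) auto
    ultimately show ?thesis unfolding \<kappa>(4) by simp
  qed
  then have "(\<lambda>e. h ` e) ` E = {e \<in> triples (h ` V). 3 \<in> \<kappa>' ` e \<or> inj_on \<kappa>' e}"
    by (auto simp: triples_def) (metis (no_types, lifting) subset_imageE image_eqI)+
  moreover have "\<kappa>' ` h ` V \<subseteq> {..3}" using \<kappa>(1) \<kappa>'h by auto
  ultimately show ?thesis unfolding join_model_def using \<kappa>(2,3) by (intro exI[of _ \<kappa>']) simp
qed

section \<open>The join of the complete and the Turan triple system as a model\<close>

lemma double_mod_3:
  fixes i y :: nat
  assumes "i < 3"
  shows "(2 * y) mod 3 = i \<longleftrightarrow> y mod 3 = (2 * i) mod 3"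
proof -
  have "(2 * y) mod 3 = (2 * (y mod 3)) mod 3" by (simp add: mod_mult_right_eq)
  moreover have "y mod 3 < 3" by simp
  then have "y mod 3 = 0 \<or> y mod 3 = 1 \<or> y mod 3 = 2" by linarith
  moreover have "i = 0 \<or> i = 1 \<or> i = 2" using assms by linarith
  ultimately show ?thesis by (elim disjE) simp_all
qed

lemma join_model_hjoin:
  assumes J_def: "J = hjoin 3 (complete_rgraph 3 t) (turan 3 s 3)"
  shows "finite (verts J)" "join_model t s (verts J) (edges J)"
proof -
  define A where "A = (Inl ` {1..t} :: (nat + nat) set)"
  define B where "B = (Inr ` {1..s} :: (nat + nat) set)"
  \<comment> \<open>Among the residue classes modulo 3 in {1..s}, class 0 is smallest and class 1
    largest. Doubling exchanges the residues 1 and 2, so the colours 0, 1, 2 come in the increasing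
    order of sizes demanded by \<open>join_model\<close>.\<close>
  define \<kappa> :: "nat + nat \<Rightarrow> nat" where "\<kappa> = case_sum (\<lambda>_. 3) (\<lambda>y. (2 * y) mod 3)"
  have \<kappa>: "\<kappa> (Inl x) = 3" "\<kappa> (Inr y) = (2 * y) mod 3" for x y by (simp_all add: \<kappa>_def)
  have V: "verts J = A \<union> B"
    by (simp add: J_def hjoin_def Let_def complete_rgraph_def turan_def A_def B_def)
  show fin: "finite (verts J)" by (simp add: V A_def B_def)
  have E: "edges J = (\<lambda>e. Inl ` e) ` {e. e \<subseteq> {1..t} \<and> card e = 3} \<union>
      (\<lambda>e. Inr ` e) ` {e. e \<subseteq> {1..s} \<and> card e = 3 \<and> (\<forall>i<3. card (e \<inter> turan_part s 3 i) \<le> 1)} \<union>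
      {e. e \<subseteq> A \<union> B \<and> card e = 3 \<and> e \<inter> A \<noteq> {} \<and> e \<inter> B \<noteq> {}}"
    by (simp add: J_def hjoin_def Let_def complete_rgraph_def turan_def A_def B_def)
  have part: "{v \<in> A \<union> B. \<kappa> v = i} = Inr ` turan_part s 3 ((2 * i) mod 3)" if "i < 3" for i
  proof -
    have "{v \<in> A \<union> B. \<kappa> v = i} = Inr ` {y \<in> {1..s}. (2 * y) mod 3 = i}"
      using that by (auto simp: A_def B_def \<kappa>)
    then show ?thesis by (simp only: double_mod_3[OF that] turan_part_def)
  qed
  have c3: "card {v \<in> A \<union> B. \<kappa> v = 3} = t"
  proof -
    have "(2 * y) mod 3 \<noteq> 3" for y :: nat using mod_less_divisor[of 3 "2 * y"] by linarith
    then have "{v \<in> A \<union> B. \<kappa> v = 3} = A" by (auto simp: A_def B_def \<kappa>)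
    then show ?thesis by (simp add: A_def card_image)
  qed
  have ci: "card {v \<in> A \<union> B. \<kappa> v = i} = (s + i) div 3" if "i < 3" for i
  proof -
    have "card {v \<in> A \<union> B. \<kappa> v = i} = card (turan_part s 3 ((2 * i) mod 3))"
      unfolding part[OF that] by (simp add: card_image)
    also have "\<dots> = (s + i) div 3"
    proof -
      consider "i = 0" | "i = 1" | "i = 2" using \<open>i < 3\<close> by linarith
      then show ?thesis
      proof cases
        case 1
        then show ?thesis by (simp add: card_turan_part)
      next
        case 2
        have "(s + 1) div 3 = s div 3 + (if 2 \<le> s mod 3 then 1 else 0)" by (auto simp: div_Suc mod_Suc)
        then show ?thesis using 2 by (simp add: card_turan_part)
      next
        case 3
        have "(s + 2) div 3 = s div 3 + (if 1 \<le> s mod 3 then 1 else 0)" by (auto simp: div_Suc mod_Suc)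
        then show ?thesis using 3 by (simp add: card_turan_part)
      qed
    qed
    finally show ?thesis .
  qed
  have tur: "(\<forall>i<3. card (e \<inter> turan_part s 3 i) \<le> 1) \<longleftrightarrow> inj_on \<kappa> (Inr ` e)"
    if e: "e \<subseteq> {1..s}" for e
  proof -
    have fe: "finite e" using e finite_subset by blast
    have "(\<forall>i<3. card (e \<inter> turan_part s 3 i) \<le> 1) \<longleftrightarrow>
        (\<forall>i<3. \<forall>x\<in>e. \<forall>y\<in>e. x mod 3 = i \<longrightarrow> y mod 3 = i \<longrightarrow> x = y)"
      using e fe by (auto simp: card_le_Suc0_iff_eq turan_part_def subset_iff)
    also have "\<dots> \<longleftrightarrow> (\<forall>x\<in>e. \<forall>y\<in>e. x mod 3 = y mod 3 \<longrightarrow> x = y)"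
    proof (intro iffI ballI impI allI)
      fix x y assume all: "\<forall>i<3. \<forall>x\<in>e. \<forall>y\<in>e. x mod 3 = i \<longrightarrow> y mod 3 = i \<longrightarrow> x = y"
        and xy: "x \<in> e" "y \<in> e" "x mod 3 = y mod 3"
      show "x = y" using all[rule_format, of "y mod 3" x y] xy by simp
    qed simp
    also have "\<dots> \<longleftrightarrow> (\<forall>x\<in>e. \<forall>y\<in>e. (2 * x) mod 3 = (2 * y) mod 3 \<longrightarrow> x = y)"
    proof -
      have "x mod 3 = y mod 3 \<longleftrightarrow> (2 * x) mod 3 = (2 * y) mod 3" for x y :: nat
        using double_mod_3[of "(2 * y) mod 3" x] double_mod_3[of "(2 * y) mod 3" y] by simp
      then show ?thesis by simp
    qed
    finally show ?thesis by (auto simp: inj_on_def \<kappa>)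
  qed
  have "edges J = {e \<in> triples (A \<union> B). 3 \<in> \<kappa> ` e \<or> inj_on \<kappa> e}"
  proof (intro set_eqI)
    fix e :: "(nat + nat) set"
    show "e \<in> edges J \<longleftrightarrow> e \<in> {e \<in> triples (A \<union> B). 3 \<in> \<kappa> ` e \<or> inj_on \<kappa> e}"
    proof (cases "e \<in> triples (A \<union> B)")
      case False
      then show ?thesis unfolding E by (auto simp: triples_def A_def B_def card_image)
    next
      case True
      then have e: "e \<subseteq> A \<union> B" "card e = 3" by (auto simp: triples_def)
      consider "e \<inter> B = {}" | "e \<inter> A = {}" "e \<inter> B \<noteq> {}" | "e \<inter> A \<noteq> {}" "e \<inter> B \<noteq> {}" by blast
      then show ?thesis
      proof cases
        case 1
        then obtain e' where e': "e = Inl ` e'" "e' \<subseteq> {1..t}"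
          using e(1) unfolding A_def by (metis Int_Un_distrib le_iff_inf subset_imageE sup_bot.right_neutral)
        then have "e \<in> edges J" using e(2) unfolding E by (auto simp: card_image)
        moreover have "e \<noteq> {}" using e(2) by auto
        then have "3 \<in> \<kappa> ` e" using e' \<kappa>(1) by (metis all_not_in_conv image_iff)
        ultimately show ?thesis using True by simp
      next
        case 2
        then obtain e' where e': "e = Inr ` e'" "e' \<subseteq> {1..s}"
          using e(1) unfolding B_def by (metis Int_Un_distrib le_iff_inf subset_imageE sup_bot.left_neutral)
        have "3 \<notin> \<kappa> ` e" using e' \<kappa>(2) by (auto simp: image_iff)
        moreover have "e \<in> edges J \<longleftrightarrow> (\<forall>i<3. card (e' \<inter> turan_part s 3 i) \<le> 1)"
        proof -
          have "e \<notin> (\<lambda>e. Inl ` e) ` X" for X :: "nat set set" using e' 2 by (auto simp: B_def)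
          moreover have "e \<in> (\<lambda>e. Inr ` e) ` X \<longleftrightarrow> e' \<in> X" for X
            unfolding e' by (simp add: inj_image_eq_iff image_iff)
          ultimately show ?thesis unfolding E using 2 e' e(2) by (simp add: card_image)
        qed
        ultimately show ?thesis using True tur[OF e'(2)] e' by simp
      next
        case 3
        then have "e \<in> edges J" using e unfolding E by auto
        moreover have "3 \<in> \<kappa> ` e" using 3(1) \<kappa>(1) unfolding A_def by (force simp: image_iff)
        ultimately show ?thesis using True by simp
      qed
    qed
  qed
  moreover have "\<kappa> ` (A \<union> B) \<subseteq> {..3}"
    by (auto simp: A_def B_def \<kappa> less_imp_le)
  ultimately show "join_model t s (verts J) (edges J)"
    unfolding join_model_def V using c3 ci by blast
qed

lemma rgraph_if_join_model:
  "join_model t s (verts G) (edges G) \<Longrightarrow> finite (verts G) \<Longrightarrow> rgraph 3 G"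
  using join_model_subset by (fastforce simp: rgraph_def triples_def)

lemma extremal_classes_T3:
  assumes s: "20 * exact_from \<le> s" and t: "real t \<le> real (s + t) / 100000"
  shows "extremal_classes 3 (s + t) (t + 1) T3 =
    {iso_class (hjoin 3 (complete_rgraph 3 t) (turan 3 s 3))}"
proof -
  define J where "J = hjoin 3 (complete_rgraph 3 t) (turan 3 s 3)"
  let ?\<F> = "free_rgraphs 3 (s + t) (t + 1) T3"
  have J: "finite (verts J)" "join_model t s (verts J) (edges J)"
    by (rule join_model_hjoin[OF J_def])+
  have free: "finite (verts G)" "edges G \<subseteq> triples (verts G)" "card (verts G) = s + t"
    "\<nexists>U. packing (edges G) (Suc t) U" if "G \<in> ?\<F>" for G
    using that contains_disjoint_copies_T3_iff[of G "Suc t"]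
    by (auto simp: free_rgraphs_def rgraph_def triples_def)
  have le: "card (edges G) \<le> join_size s t" if "G \<in> ?\<F>" for G
    using packing_free_bound[OF free(1-3)[OF that] s t free(4)[OF that]] by blast
  have model: "join_model t s (verts G) (edges G)" if "G \<in> ?\<F>" "card (edges G) = join_size s t" for G
    using packing_free_bound[OF free(1-3)[OF that(1)] s t free(4)[OF that(1)]] that(2) by blast
  have iso: "iso_class G = iso_class J" if "join_model t s (verts G) (edges G)" "finite (verts G)" for G :: "nat hypergraph"
    using join_model_unique[OF that J(2,1)] iso_class_eq[of G J] rgraph_if_join_model[OF that] by simp
  \<comment> \<open>Even and odd numbers house the two summands. The copy \<open>G0\<close> of the
    join obtained in this way shows that \<open>join_size s t\<close> is attained.\<close>
  define h :: "nat + nat \<Rightarrow> nat" where "h = case_sum (\<lambda>x. 2 * x) (\<lambda>y. 2 * y + 1)"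
  have "inj h"
    unfolding h_def by (rule injI) (auto split: sum.splits, presburger+)
  define G0 where "G0 = Hypergraph (h ` verts J) ((\<lambda>e. h ` e) ` edges J)"
  have G0: "join_model t s (verts G0) (edges G0)" "finite (verts G0)"
    using join_model_image[OF J(2) \<open>inj h\<close>] J(1) by (simp_all add: G0_def)
  have G0F: "G0 \<in> ?\<F>"
    using contains_disjoint_copies_T3_iff[of G0 "Suc t"] rgraph_if_join_model[OF G0]
      join_model_no_packing[OF G0] join_model_card_verts[OF G0]
    by (simp add: free_rgraphs_def)
  have G0E: "card (edges G0) = join_size s t" by (rule join_model_card_edges[OF G0])
  have "{G \<in> ?\<F>. \<forall>H\<in>?\<F>. card (edges H) \<le> card (edges G)} = {G \<in> ?\<F>. card (edges G) = join_size s t}"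
    using le G0F G0E by (auto intro: le_antisym) (metis le_antisym)
  then have "extremal_classes 3 (s + t) (t + 1) T3 = iso_class ` {G \<in> ?\<F>. card (edges G) = join_size s t}"
    unfolding extremal_classes_def by simp
  also have "\<dots> = {iso_class J}"
  proof
    show "iso_class ` {G \<in> ?\<F>. card (edges G) = join_size s t} \<subseteq> {iso_class J}"
      using iso model free(1) by blast
    show "{iso_class J} \<subseteq> iso_class ` {G \<in> ?\<F>. card (edges G) = join_size s t}"
      using iso[OF G0] G0F G0E by blast
  qed
  finally show ?thesis by (simp add: J_def)
qed

theorem theorem2p3:
  shows "\<exists>(N0::nat) (c::real). c > 0 \<and>
    (\<forall>n t :: nat. n \<ge> N0 \<and> real t \<le> c * real n \<longrightarrow>
       extremal_classes 3 n (t + 1) T3 = {iso_class (hjoin 3 (complete_rgraph 3 t) (turan 3 (n - t) 3))})"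
proof (intro exI[of _ "40 * exact_from"] exI[of _ "1/100000 :: real"] conjI allI impI)
  fix n t :: nat
  assume nt: "40 * exact_from \<le> n \<and> real t \<le> 1/100000 * real n"
  \<comment> \<open>At least half of the vertices remain after removing \<open>t\<close>, which
    turns \<open>40 * exact_from\<close> into the bound \<open>20 * exact_from\<close> required of
    \<open>n - t\<close>.\<close>
  then have "real t \<le> real n / 2" by simp
  then have t: "2 * t \<le> n" by linarith
  then have n: "n = (n - t) + t" "20 * exact_from \<le> n - t" using nt by linarith+
  show "extremal_classes 3 n (t + 1) T3 = {iso_class (hjoin 3 (complete_rgraph 3 t) (turan 3 (n - t) 3))}"
    using extremal_classes_T3[OF n(2), of t] nt n(1) by simp
qed simp

end
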